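(* Let $(\mathbb B,\|\cdot\|_{\mathbb B})$ be a separable Banach space with dual $(\mathbb B^*,\|\cdot\|_{\mathbb B^*})$, let $p\in[1,\infty)$, and let $f:\mathscr P_p(\mathbb B)\to\mathbb R$ be continuous. Let $(\xi_\varepsilon)_{\varepsilon\in[0,1]}$ be a family of $\mathbb B$-valued random variables on a complete probability space $(\Omega,\mathscr F,\mathbb P)$ with $\mathscr L_{\xi_\varepsilon}\in\mathscr P_p(\mathbb B)$, such that $\dot\xi_0:=\lim_{\varepsilon\downarrow0}\frac{\xi_\varepsilon-\xi_0}{\varepsilon}$ exists in $L^p(\Omega\to\mathbb B,\mathbb P)$. Assume that either $\xi_\varepsilon$ is continuous in $\varepsilon\in[0,1]$, or the probability space is Polish (i.e. $\mathscr F$ is the $\mathbb P$-complete Borel $\sigma$-field induced by a Polish metric on $\Omega$). Put $\mu_0:=\mathscr L_{\xi_0}$. (1) Let $\mu_0$ be atomless. If $f$ is $L$-differentiable such that $D^Lf(\mu_0)$ has a continuous version satisfying, for some constant $C>0$, $$\|D^Lf(\mu_0)(x)\|_{\mathbb B^*}\le C\big(1+\|x\|_{\mathbb B}^{p/p^*}1_{\{p>1\}}\big),\quad x\in\mathbb B,$$ then $$\lim_{\varepsilon\downarrow0}\frac{f(\mathscr L_{\xi_\varepsilon})-f(\mathscr L_{\xi_0})}{\varepsilon}=\mathbb E\big[{}_{\mathbb B^*}\langle D^Lf(\mu_0)(\xi_0),\dot\xi_0\rangle_{\mathbb B}\big].\qquad( * )$$ (2) If $f$ is $L$-differentiable in a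 neighbourhood $O$ of $\mu_0$ such that $D^Lf$ has a version jointly continuous in $(x,\mu)\in\mathbb B\times O$ satisfying, for some constant $C>0$, $$\|D^Lf(\mu)(x)\|_{\mathbb B^*}\le C\big(1+\|x\|_{\mathbb B}^{p/p^*}1_{\{p>1\}}\big),\quad (x,\mu)\in\mathbb B\times O,$$ then $( * )$ holds.
   Context: $\mathscr L_\xi$ is the law of a random variable $\xi$. $p^*=\frac p{p-1}$ if $p>1$ and $p^*=\infty$ if $p=1$. $\mathscr P_p(\mathbb B)$ is the set of probability measures $\mu$ on $\mathbb B$ with $\|\mu\|_p:=\{\mu(\|\cdot\|_{\mathbb B}^p)\}^{1/p}<\infty$, equipped with the $L^p$-Wasserstein distance $\mathbb W_p(\mu_1,\mu_2)=\inf_{\pi\in\mathcal C(\mu_1,\mu_2)}\big(\int\|x-y\|_{\mathbb B}^p\,\pi(dx,dy)\big)^{1/p}$, $\mathcal C(\mu_1,\mu_2)$ being the set of couplings; continuity and neighbourhoods are with respect to $\mathbb W_p$. ${}_{\mathbb B^*}\langle\cdot,\cdot\rangle_{\mathbb B}$ is the duality pairing. For $\mu\in\mathscr P_p(\mathbb B)$ let $T_{\mu,p}=L^p(\mathbb B\to\mathbb B;\mu)$ with norm $\|\phi\|_{T_{\mu,p}}=\{\mu(\|\phi\|_{\mathbb B}^p)\}^{1/p}$, and $T_{\mu,p}^*=L^{p^*}(\mathbb B\to\mathbb B^*;\mu)$. A continuous $f:\mathscr P_p(\mathbb B)\to\mathbb R$ is intrinsically differentiable at $\mu$ if $\phi\mapsto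 D^L_\phi f(\mu):=\lim_{\varepsilon\downarrow0}\varepsilon^{-1}\{f(\mu\circ(\mathrm{Id}+\varepsilon\phi)^{-1})-f(\mu)\}$ is a well-defined bounded linear functional on $T_{\mu,p}$; the intrinsic derivative $D^Lf(\mu)\in T^*_{\mu,p}$ is the unique element with $\int_{\mathbb B}{}_{\mathbb B^*}\langle D^Lf(\mu)(x),\phi(x)\rangle_{\mathbb B}\,\mu(dx)=D^L_\phi f(\mu)$ for all $\phi\in T_{\mu,p}$. If moreover $\lim_{\|\phi\|_{T_{\mu,p}}\downarrow0}\frac{|f(\mu\circ(\mathrm{Id}+\phi)^{-1})-f(\mu)-D^L_\phi f(\mu)|}{\|\phi\|_{T_{\mu,p}}}=0$, then $f$ is called $L$-differentiable at $\mu$ with $L$-derivative $D^Lf(\mu)$. *)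

theory Defs
  imports "HOL-Probability.Probability"
begin

section \<open>Conjugate exponents and Bochner spaces\<close>

definition conj_exponent :: "real \<Rightarrow> ereal" where
  "conj_exponent p = (if p > 1 then ereal (p / (p - 1)) else \<infinity>)"

text \<open>
  Measurability in the Bochner sense: the dual of a separable space need not be separable, so the
  almost everywhere separable range is required explicitly.
\<close>
definition strongly_measurable :: "'a measure \<Rightarrow> ('a \<Rightarrow> 'b::real_normed_vector) \<Rightarrow> bool" where
  "strongly_measurable M g \<longleftrightarrow>
     g \<in> borel_measurable M \<and> (\<exists>A. countable A \<and> (AE x in M. g x \<in> closure A))"

text \<open>
  Elements are functions rather than almost everywhere equivalence classes, so a version of
  \<open>g\<close> is a function that agrees with \<open>g\<close> almost everywhere.
\<close>
definition Lspace :: "ereal \<Rightarrow> 'a measure \<Rightarrow> ('a \<Rightarrow> 'b::real_normed_vector) set" where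
  "Lspace q M = {g. strongly_measurable M g \<and>
     (if q = \<infinity> then \<exists>K. AE x in M. norm (g x) \<le> K
      else integrable M (\<lambda>x. norm (g x) powr real_of_ereal q))}"

definition Lnorm :: "real \<Rightarrow> 'a measure \<Rightarrow> ('a \<Rightarrow> 'b::real_normed_vector) \<Rightarrow> real" where
  "Lnorm p M g = (\<integral>x. norm (g x) powr p \<partial>M) powr (1 / p)"


section \<open>The Wasserstein space\<close>

definition Prob_p ::
    "real \<Rightarrow> 'b::{banach, second_countable_topology} measure set" where
  "Prob_p p = {\<mu>. prob_space \<mu> \<and> sets \<mu> = sets borel \<and> integrable \<mu> (\<lambda>x. norm x powr p)}"

definition couplings ::
    "'b::{banach, second_countable_topology} measure \<Rightarrow> 'b measure \<Rightarrow> ('b \<times> 'b) measure set" where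
  "couplings \<mu> \<nu> = {\<pi>. prob_space \<pi> \<and> sets \<pi> = sets (borel \<Otimes>\<^sub>M borel) \<and>
     distr \<pi> borel fst = \<mu> \<and> distr \<pi> borel snd = \<nu>}"

text \<open>
  Only used on \<open>Prob_p p\<close>, where the set of couplings is nonempty and all integrals are finite.
\<close>
definition Wasserstein ::
    "real \<Rightarrow> 'b::{banach, second_countable_topology} measure \<Rightarrow> 'b measure \<Rightarrow> real" where
  "Wasserstein p \<mu> \<nu> =
     (INF \<pi>\<in>couplings \<mu> \<nu>. (\<integral>z. norm (fst z - snd z) powr p \<partial>\<pi>) powr (1 / p))"

definition W_continuous ::
    "real \<Rightarrow> ('b::{banach, second_countable_topology} measure \<Rightarrow> real) \<Rightarrow> bool" where
  "W_continuous p f \<longleftrightarrow>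
     (\<forall>\<mu>\<in>Prob_p p. \<forall>e>0. \<exists>d>0. \<forall>\<nu>\<in>Prob_p p. Wasserstein p \<mu> \<nu> < d \<longrightarrow> \<bar>f \<nu> - f \<mu>\<bar> < e)"

definition W_neighbourhood ::
    "real \<Rightarrow> 'b::{banach, second_countable_topology} measure \<Rightarrow> 'b measure set \<Rightarrow> bool" where
  "W_neighbourhood p \<mu> U \<longleftrightarrow>
     U \<subseteq> Prob_p p \<and> (\<exists>r>0. {\<nu>\<in>Prob_p p. Wasserstein p \<mu> \<nu> < r} \<subseteq> U)"

definition W_jointly_continuous_on ::
    "real \<Rightarrow> 'b::{banach, second_countable_topology} measure set \<Rightarrow>
     ('b measure \<Rightarrow> 'b \<Rightarrow> 'c::real_normed_vector) \<Rightarrow> bool" where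
  "W_jointly_continuous_on p U V \<longleftrightarrow>
     (\<forall>x. \<forall>\<mu>\<in>U. \<forall>e>0. \<exists>d>0. \<forall>y. \<forall>\<nu>\<in>U.
        norm (y - x) < d \<and> Wasserstein p \<mu> \<nu> < d \<longrightarrow> norm (V \<nu> y - V \<mu> x) < e)"


section \<open>Intrinsic and L-derivatives\<close>

abbreviation tangent ::
    "real \<Rightarrow> 'b::{banach, second_countable_topology} measure \<Rightarrow> ('b \<Rightarrow> 'b) set" where
  "tangent p \<mu> \<equiv> Lspace (ereal p) \<mu>"

abbreviation cotangent ::
    "real \<Rightarrow> 'b::{banach, second_countable_topology} measure \<Rightarrow> ('b \<Rightarrow> ('b \<Rightarrow>\<^sub>L real)) set" where
  "cotangent p \<mu> \<equiv> Lspace (conj_exponent p) \<mu>"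

definition diff_quotient ::
    "('b::{banach, second_countable_topology} measure \<Rightarrow> real) \<Rightarrow> 'b measure \<Rightarrow>
     ('b \<Rightarrow> 'b) \<Rightarrow> real \<Rightarrow> real" where
  "diff_quotient f \<mu> \<phi> \<epsilon> = (f (distr \<mu> borel (\<lambda>x. x + \<epsilon> *\<^sub>R \<phi> x)) - f \<mu>) / \<epsilon>"

definition dir_derivative ::
    "('b::{banach, second_countable_topology} measure \<Rightarrow> real) \<Rightarrow> 'b measure \<Rightarrow>
     ('b \<Rightarrow> 'b) \<Rightarrow> real" where
  "dir_derivative f \<mu> \<phi> = Lim (at_right 0) (diff_quotient f \<mu> \<phi>)"

definition intrinsically_differentiable ::
    "real \<Rightarrow> ('b::{banach, second_countable_topology} measure \<Rightarrow> real) \<Rightarrow> 'b measure \<Rightarrow> bool" where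
  "intrinsically_differentiable p f \<mu> \<longleftrightarrow>
     (\<forall>\<phi>\<in>tangent p \<mu>. \<exists>l. (diff_quotient f \<mu> \<phi> \<longlongrightarrow> l) (at_right 0)) \<and>
     (\<forall>\<phi>\<in>tangent p \<mu>. \<forall>\<psi>\<in>tangent p \<mu>. \<forall>a b.
        dir_derivative f \<mu> (\<lambda>x. a *\<^sub>R \<phi> x + b *\<^sub>R \<psi> x)
          = a * dir_derivative f \<mu> \<phi> + b * dir_derivative f \<mu> \<psi>) \<and>
     (\<exists>K. \<forall>\<phi>\<in>tangent p \<mu>. \<bar>dir_derivative f \<mu> \<phi>\<bar> \<le> K * Lnorm p \<mu> \<phi>)"

text \<open>
  Derivatives are predicates on representatives: the representing element of the cotangent space
  is determined only up to \<open>\<mu>\<close>-null sets.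
\<close>
definition has_intrinsic_derivative ::
    "real \<Rightarrow> ('b::{banach, second_countable_topology} measure \<Rightarrow> real) \<Rightarrow> 'b measure \<Rightarrow>
     ('b \<Rightarrow> ('b \<Rightarrow>\<^sub>L real)) \<Rightarrow> bool" where
  "has_intrinsic_derivative p f \<mu> D \<longleftrightarrow>
     intrinsically_differentiable p f \<mu> \<and> D \<in> cotangent p \<mu> \<and>
     (\<forall>\<phi>\<in>tangent p \<mu>. (\<integral>x. blinfun_apply (D x) (\<phi> x) \<partial>\<mu>) = dir_derivative f \<mu> \<phi>)"

definition has_L_derivative ::
    "real \<Rightarrow> ('b::{banach, second_countable_topology} measure \<Rightarrow> real) \<Rightarrow> 'b measure \<Rightarrow>
     ('b \<Rightarrow> ('b \<Rightarrow>\<^sub>L real)) \<Rightarrow> bool" where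
  "has_L_derivative p f \<mu> D \<longleftrightarrow>
     has_intrinsic_derivative p f \<mu> D \<and>
     (\<forall>e>0. \<exists>d>0. \<forall>\<phi>\<in>tangent p \<mu>. 0 < Lnorm p \<mu> \<phi> \<and> Lnorm p \<mu> \<phi> < d \<longrightarrow>
        \<bar>f (distr \<mu> borel (\<lambda>x. x + \<phi> x)) - f \<mu> - dir_derivative f \<mu> \<phi>\<bar> / Lnorm p \<mu> \<phi> < e)"

text \<open>The exponent \<open>p / conj_exponent p\<close> is \<open>p - 1\<close> for \<open>p > 1\<close>.\<close>
definition growth_bound :: "real \<Rightarrow> real \<Rightarrow> ('b::real_normed_vector \<Rightarrow> ('b \<Rightarrow>\<^sub>L real)) \<Rightarrow> bool" where
  "growth_bound p C V \<longleftrightarrow>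
     (\<forall>x. norm (V x) \<le>
        C * (1 + norm x powr real_of_ereal (ereal p / conj_exponent p) * of_bool (p > 1)))"


section \<open>Probability spaces and random variables\<close>

definition atomless :: "'a measure \<Rightarrow> bool" where
  "atomless M \<longleftrightarrow>
     (\<forall>A\<in>sets M. 0 < emeasure M A \<longrightarrow>
        (\<exists>B\<in>sets M. B \<subseteq> A \<and> 0 < emeasure M B \<and> emeasure M B < emeasure M A))"

definition Polish_prob_space :: "'w measure \<Rightarrow> bool" where
  "Polish_prob_space M \<longleftrightarrow> prob_space M \<and>
     (\<exists>d N. Metric_space (space M) d \<and> Metric_space.mcomplete (space M) d \<and>
        separable_space (Metric_space.mtopology (space M) d) \<and>
        sets N = sigma_sets (space M) {U. openin (Metric_space.mtopology (space M) d) U} \<and>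
        M = completion N)"

definition Lp_right_derivative ::
    "real \<Rightarrow> 'w measure \<Rightarrow> (real \<Rightarrow> 'w \<Rightarrow> 'b::{banach, second_countable_topology}) \<Rightarrow>
     ('w \<Rightarrow> 'b) \<Rightarrow> bool" where
  "Lp_right_derivative p M \<xi> \<eta> \<longleftrightarrow> \<eta> \<in> Lspace (ereal p) M \<and>
     ((\<lambda>\<epsilon>. Lnorm p M (\<lambda>\<omega>. (\<xi> \<epsilon> \<omega> - \<xi> 0 \<omega>) /\<^sub>R \<epsilon> - \<eta> \<omega>)) \<longlongrightarrow> 0) (at_right 0)"

text \<open>
  Integrability is stated because the integral of a non-integrable function is \<open>0\<close> by convention.
\<close>
definition chain_rule ::
    "'w measure \<Rightarrow> ('b::{banach, second_countable_topology} measure \<Rightarrow> real) \<Rightarrow>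
     (real \<Rightarrow> 'w \<Rightarrow> 'b) \<Rightarrow> ('w \<Rightarrow> 'b) \<Rightarrow> ('b \<Rightarrow> ('b \<Rightarrow>\<^sub>L real)) \<Rightarrow> bool" where
  "chain_rule M f \<xi> \<eta> D \<longleftrightarrow>
     integrable M (\<lambda>\<omega>. blinfun_apply (D (\<xi> 0 \<omega>)) (\<eta> \<omega>)) \<and>
     ((\<lambda>\<epsilon>. (f (distr M borel (\<xi> \<epsilon>)) - f (distr M borel (\<xi> 0))) / \<epsilon>)
        \<longlongrightarrow> (\<integral>\<omega>. blinfun_apply (D (\<xi> 0 \<omega>)) (\<eta> \<omega>) \<partial>M)) (at_right 0)"

end

theory Submission
  imports Defs
begin

text \<open>
  If the law \<open>\<mu>\<close> of \<open>X\<close> has no atoms, every \<open>Y\<close> can be imitated by a map on the state space: discretize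
  \<open>X\<close> and \<open>Y\<close> at scale \<open>\<delta>\<close>, and cut each cell of \<open>X\<close> into pieces whose \<open>\<mu>\<close>-masses are the joint
  probabilities of the cells of \<open>X\<close> and \<open>Y\<close>. The map \<open>T\<close> that is constant on the pieces has, together with
  the discretized identity, the joint law of the discretized pair, so \<open>L\<close>-differentiability of \<open>f\<close> along
  \<open>T - Id\<close> turns, as \<open>\<delta> \<longlonglongrightarrow> 0\<close>, into Frechet differentiability at \<open>X\<close> of the lift of \<open>f\<close> to \<open>L\<^sup>p\<close>. This gives
  part (1). For part (2), adjoin an independent uniform
  variable and perturb by small noise in a fixed direction, which removes the atoms; apply the mean
  value theorem to the lift along the perturbed segment from \<open>\<xi> 0\<close> to \<open>\<xi> \<epsilon>\<close>, and let noise and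
  \<open>\<epsilon>\<close> tend to \<open>0\<close> together, using joint continuity of the derivative and dominated convergence.
\<close>

text \<open>\<open>L\<close>-differentiability tests only perturbations of \<open>X\<close> that are
  functions of \<open>X\<close>, while \<open>Y - X\<close> may carry further randomness. A map
  \<open>T\<close> for which \<open>(Id, T)\<close> has exactly the law of \<open>(X, Y)\<close>
  exists only when that law sits on a graph, so the imitation has to be approximate, and the
  continuity of \<open>f\<close> closes the gap. The pairing with the derivative must survive the
  rounding too, which is why the cells of \<open>X\<close> are made small for the derivative as well
  as for the norm.

  In part (2) the lift is differentiable at the noisy points, but nothing makes its remainders
  uniform as the noise shrinks. The mean value theorem yields an identity without remainder, at an
  intermediate point whose law still lies in the neighbourhood. For each \<open>\<epsilon>\<close>
  the noise is chosen so small that it changes \<open>f\<close> by less than the square of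
  \<open>\<epsilon>\<close>, which disappears in the difference quotient. One direction of noise
  suffices even in infinite dimension, because a line with nonzero direction meets each point at
  most once.\<close>

subsection \<open>Splitting a measure without atoms\<close>

text \<open>This is the probability integral transform for a measure of arbitrary finite mass:
  without atoms \<open>cdf M\<close> is continuous, and it carries \<open>M\<close> to Lebesgue
  measure on the interval from 0 to the total mass.\<close>

lemma (in finite_borel_measure) measure_cdf_less:
  assumes no_atoms: "\<And>t. measure M {t} = 0" and c: "0 \<le> c" "c \<le> measure M (space M)"
  shows "measure M {t. cdf M t < c} = c"
proof -
  have cont: "continuous_on UNIV (cdf M)"
    using no_atoms by (simp add: continuous_on_eq_continuous_at isCont_cdf)
  have attained: "\<exists>t. cdf M t = u" if u: "0 < u" "u < measure M (space M)" for u
  proof -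
    have "eventually (\<lambda>t. cdf M t < u) at_bot"
      using cdf_lim_at_bot u(1) by (rule order_tendstoD)
    then obtain a where a: "cdf M a < u"
      by (auto simp: eventually_at_bot_linorder)
    have "eventually (\<lambda>t. cdf M t > u) at_top"
      using cdf_lim_at_top u(2) by (rule order_tendstoD)
    then obtain b where b: "u < cdf M b"
      by (auto simp: eventually_at_top_linorder)
    have "a \<le> b"
      using a b cdf_nondecreasing[of b a] by linarith
    then show ?thesis
      using IVT'[of "cdf M" a u b] a b continuous_on_subset[OF cont] by fastforce
  qed
  have meas: "{t. cdf M t < c} \<in> sets M"
  proof -
    have "open {t. cdf M t < c}"
      using open_Collect_less[OF cont continuous_on_const] .
    then show ?thesis by (simp add: M_is_borel)
  qed
  show ?thesis
  proof (rule antisym)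
    show "measure M {t. cdf M t < c} \<le> c"
    proof (cases "0 < c \<and> c < measure M (space M)")
      case True
      then obtain t0 where t0: "cdf M t0 = c"
        using attained by auto
      have "{t. cdf M t < c} \<subseteq> {..t0}"
        using cdf_nondecreasing[of t0] t0 by (auto simp: not_le[symmetric]) (meson not_le order_less_imp_le)
      then show ?thesis
        unfolding t0[symmetric] cdf_def2 by (intro finite_measure_mono) (auto simp: M_is_borel)
    next
      case False
      show ?thesis
      proof (cases "c = 0")
        case True
        then have "{t. cdf M t < c} = {}"
          using cdf_nonneg by (auto simp: not_less)
        then show ?thesis using c by simp
      next
        case False
        with c \<open>\<not> (0 < c \<and> c < measure M (space M))\<close> have "c = measure M (space M)" by linarith
        then show ?thesis using bounded_measure by simp
      qed
    qed
    \<comment> \<open>The total mass may be a supremum that \<open>cdf M\<close> never reaches, so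
      the lower bound uses the positive values \<open>u\<close> below \<open>c\<close>, which are
      attained.\<close>
    show "c \<le> measure M {t. cdf M t < c}"
    proof (rule dense_le)
      fix u assume u: "u < c"
      show "u \<le> measure M {t. cdf M t < c}"
      proof (cases "0 < u")
        case True
        then obtain t where t: "cdf M t = u"
          using attained[of u] u c by fastforce
        have "{..t} \<subseteq> {t. cdf M t < c}"
          using cdf_nondecreasing[of _ t] t u by force
        then have "measure M {..t} \<le> measure M {t. cdf M t < c}"
          by (intro finite_measure_mono meas)
        then show ?thesis using t by (simp add: cdf_def2)
      next
        case False
        then show ?thesis
          using measure_nonneg[of M "{t. cdf M t < c}"] by linarith
      qed
    qed
  qed
qed

text \<open>The digits are 0 and 1 but the base is 3: the terms after the first disagreement at
  \<open>n\<close> add up to at most half of \<open>(1/3)^n\<close> and cannot cancel it. In base 2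
  they could, as in 0.1000... = 0.0111... .\<close>

lemma ternary_expansion_inj:
  fixes a b :: "nat \<Rightarrow> bool"
  assumes eq: "(\<Sum>n. (1/3)^n * of_bool (a n) :: real) = (\<Sum>n. (1/3)^n * of_bool (b n))"
  shows "a = b"
proof (rule ccontr)
  assume "a \<noteq> b"
  then have ex: "\<exists>n. a n \<noteq> b n" by auto
  define n where "n = (LEAST n. a n \<noteq> b n)"
  have less: "a k = b k" if "k < n" for k
    using not_less_Least[of k "\<lambda>n. a n \<noteq> b n"] that unfolding n_def by blast
  have n: "a n \<noteq> b n" using LeastI_ex[OF ex] unfolding n_def .
  have sm: "summable (\<lambda>n. (1/3)^n * of_bool (c n) :: real)" for c
    by (rule summable_comparison_test'[where g="\<lambda>n. (1/3)^n" and N=0]) (auto simp: summable_geometric)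
  define d where "d k = (1/3)^k * (of_bool (a k) - of_bool (b k) :: real)" for k
  have sd: "summable d"
    unfolding d_def using summable_diff[OF sm[of a] sm[of b]] by (simp add: algebra_simps)
  have d_le: "\<bar>d (k + Suc n)\<bar> \<le> (1/3)^Suc n * (1/3)^k" for k
    by (auto simp: d_def power_add of_bool_def)
  have g_summable: "summable (\<lambda>k. (1/3)^Suc n * (1/3)^k :: real)"
    by (intro summable_mult summable_geometric) simp
  have abs_summable: "summable (\<lambda>k. \<bar>d (k + Suc n)\<bar>)"
    by (rule summable_comparison_test'[OF g_summable, of 0]) (use d_le in simp)
  have "(\<Sum>k. d k) = 0"
    unfolding d_def using suminf_diff[OF sm[of a] sm[of b]] eq by (simp add: algebra_simps)
  moreover have "(\<Sum>k. d k) = (\<Sum>k. d (k + Suc n)) + (\<Sum>k<Suc n. d k)"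
    using suminf_split_initial_segment[OF sd] .
  moreover have "(\<Sum>k<Suc n. d k) = d n"
    using less by (simp add: d_def)
  ultimately have "\<bar>d n\<bar> = \<bar>\<Sum>k. d (k + Suc n)\<bar>" by linarith
  also have "\<dots> \<le> (\<Sum>k. \<bar>d (k + Suc n)\<bar>)"
    by (rule summable_rabs[OF abs_summable])
  also have "\<dots> \<le> (\<Sum>k. (1/3)^Suc n * (1/3)^k)"
    by (rule suminf_le[OF d_le abs_summable g_summable])
  also have "\<dots> = (1/3)^Suc n * (3/2)"
    by (subst suminf_mult) (auto simp: suminf_geometric summable_geometric)
  also have "\<dots> < (1/3)^n" by simp
  also have "(1/3)^n = \<bar>d n\<bar>"
    using n by (auto simp: d_def)
  finally show False by simp
qed

text \<open>The digits of \<open>h x\<close> record which sets of a countable basis contain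
  \<open>x\<close>, and by the T0 axiom these records separate points. Injectivity keeps the image
  of a measure without atoms free of atoms, so that its distribution function can be used for
  splitting.\<close>

lemma exists_inj_borel_real:
  obtains h :: "'b::{second_countable_topology, t0_space} \<Rightarrow> real"
  where "h \<in> borel_measurable borel" "inj h"
proof -
  obtain B :: "'b set set" where B: "countable B" "topological_basis B"
    using ex_countable_basis by blast
  \<comment> \<open>Adding the open set \<open>{}\<close> makes the family nonempty, as its
    enumeration by \<open>from_nat_into\<close> requires.\<close>
  define U where "U = from_nat_into (insert {} B)"
  have rng: "range U = insert {} B"
    unfolding U_def using B by (intro range_from_nat_into) auto
  have oU: "open (U n)" for n
    using B(2) rng topological_basis_open[of B] by (metis insert_iff open_empty rangeI)
  define h where "h x = (\<Sum>n. (1/3)^n * of_bool (x \<in> U n) :: real)" for x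
  have "h \<in> borel_measurable borel"
  proof -
    have [measurable]: "U n \<in> sets borel" for n using oU by simp
    show ?thesis unfolding h_def by measurable
  qed
  moreover have "inj h"
  proof (rule injI)
    fix x y assume "h x = h y"
    then have *: "(\<lambda>n. x \<in> U n) = (\<lambda>n. y \<in> U n)"
      unfolding h_def by (rule ternary_expansion_inj)
    show "x = y"
    proof (rule ccontr)
      assume "x \<noteq> y"
      then obtain S where S: "open S" "x \<in> S \<longleftrightarrow> y \<notin> S"
        using separation_t0[of x y] \<open>x \<noteq> y\<close> by auto
      have "\<exists>b\<in>B. (x \<in> b) \<noteq> (y \<in> b)"
        using topological_basisE[OF B(2) S(1)] S(2) by (metis subsetD)
      then show False using * rng by (metis insertI2 rangeE)
    qed
  qed
  ultimately show ?thesis using that by blast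
qed

text \<open>Inside the cell \<open>\<iota> x = i\<close> the function \<open>G\<close> of the proof
  is distributed like Lebesgue measure on the interval from 0 to the mass of the cell. Cutting this
  interval into consecutive pieces of lengths \<open>m i j\<close> cuts the cell into pieces of
  these masses, and \<open>\<tau>\<close> numbers the pieces.\<close>

lemma exists_splitting_map:
  fixes \<mu> :: "'b::{second_countable_topology, t1_space} measure" and \<iota> :: "'b \<Rightarrow> nat"
    and m :: "nat \<Rightarrow> nat \<Rightarrow> real"
  assumes "finite_measure \<mu>" and sets_eq: "sets \<mu> = sets borel"
    and no_atoms: "\<And>x. measure \<mu> {x} = 0"
    and \<iota>[measurable]: "\<iota> \<in> measurable borel (count_space UNIV)"
    and m_nonneg: "\<And>i j. 0 \<le> m i j"
    and m_sums: "\<And>i. m i sums measure \<mu> {x. \<iota> x = i}"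
  obtains \<tau> :: "'b \<Rightarrow> nat" where "\<tau> \<in> measurable borel (count_space UNIV)"
    "\<And>i j. measure \<mu> {x. \<iota> x = i \<and> \<tau> x = j} = m i j"
proof -
  interpret finite_measure \<mu> by fact
  note [measurable_cong] = sets_eq
  have space_eq: "space \<mu> = UNIV"
    using sets_eq_imp_space_eq[OF sets_eq] by simp
  obtain h :: "'b \<Rightarrow> real" where h[measurable]: "h \<in> borel_measurable borel" and inj: "inj h"
    using exists_inj_borel_real by blast
  \<comment> \<open>The part of \<open>\<mu>\<close> in cell \<open>i\<close>, moved to the line
    without normalization, so that cells of mass 0 need no separate treatment.\<close>
  define N where "N i = distr (restrict_space \<mu> {x. \<iota> x = i}) borel h" for i
  have A[measurable]: "{x. \<iota> x = i} \<in> sets borel" for i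
    by measurable
  have hr[measurable]: "h \<in> borel_measurable (restrict_space \<mu> {x. \<iota> x = i})" for i
    by (rule measurable_restrict_space1) measurable
  have N_eq: "measure (N i) S = measure \<mu> {x. \<iota> x = i \<and> h x \<in> S}" if S: "S \<in> sets borel" for i S
  proof -
    have "measure (N i) S = measure (restrict_space \<mu> {x. \<iota> x = i}) (h -` S \<inter> {x. \<iota> x = i})"
      unfolding N_def by (subst measure_distr) (use S in \<open>auto simp: space_restrict_space space_eq\<close>)
    also have "\<dots> = measure \<mu> (h -` S \<inter> {x. \<iota> x = i})"
      by (rule measure_restrict_space) (auto simp: space_eq sets_eq)
    also have "h -` S \<inter> {x. \<iota> x = i} = {x. \<iota> x = i \<and> h x \<in> S}" by auto
    finally show ?thesis .
  qed
  have fbm: "finite_borel_measure (N i)" for i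
  proof -
    have "finite_measure (N i)" unfolding N_def
      by (intro finite_measure.finite_measure_distr finite_measure_restrict_space hr) (auto simp: sets_eq space_eq \<open>finite_measure \<mu>\<close>)
    then show ?thesis
      by (auto simp: finite_borel_measure_def finite_borel_measure_axioms_def N_def)
  qed
  have N_atom: "measure (N i) {t} = 0" for i t
  proof -
    \<comment> \<open>By injectivity the fibre of \<open>h\<close> over \<open>t\<close> has at most
      one point.\<close>
    have "measure (N i) {t} \<le> measure \<mu> (if t \<in> range h then {inv h t} else {})"
      unfolding N_eq[OF borel_singleton[OF sets.empty_sets]]
      by (intro finite_measure_mono) (use inj in \<open>auto simp: sets_eq inj_def\<close>)
    also have "\<dots> = 0" using no_atoms by auto
    finally show ?thesis using measure_nonneg[of "N i" "{t}"] by linarith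
  qed
  have N_space: "measure (N i) (space (N i)) = measure \<mu> {x. \<iota> x = i}" for i
    using N_eq[of UNIV i] by (simp add: N_def)
  define G where "G x = cdf (N (\<iota> x)) (h x)" for x
  have cdf_meas[measurable]: "cdf (N i) \<in> borel_measurable borel" for i
    using finite_borel_measure.cdf_nondecreasing[OF fbm]
    by (intro borel_measurable_mono monoI) auto
  have G_meas[measurable]: "G \<in> borel_measurable borel"
    unfolding G_def by (rule measurable_compose_countable[OF _ \<iota>]) measurable
  have G_less: "measure \<mu> {x. \<iota> x = i \<and> G x < c} = c"
    if "0 \<le> c" "c \<le> measure \<mu> {x. \<iota> x = i}" for i c
  proof -
    have "measure \<mu> {x. \<iota> x = i \<and> G x < c} = measure \<mu> {x. \<iota> x = i \<and> h x \<in> {t. cdf (N i) t < c}}"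
      by (rule arg_cong[where f="measure \<mu>"]) (auto simp: G_def)
    also have "\<dots> = measure (N i) {t. cdf (N i) t < c}"
      by (subst N_eq) auto
    also have "\<dots> = c"
      using finite_borel_measure.measure_cdf_less[OF fbm N_atom] that by (simp add: N_space)
    finally show ?thesis .
  qed
  define s where "s i j = (\<Sum>k<j. m i k)" for i j
  have s_mono: "s i j \<le> s i (Suc j)" for i j
    unfolding s_def using m_nonneg by simp
  have s_incseq: "incseq (s i)" for i
    using s_mono by (auto simp: incseq_Suc_iff)
  have s_nonneg: "0 \<le> s i j" for i j
    unfolding s_def using m_nonneg by (simp add: sum_nonneg)
  have s_lim: "s i \<longlonglongrightarrow> measure \<mu> {x. \<iota> x = i}" for i
    using m_sums[of i] unfolding sums_def s_def .
  have s_le: "s i j \<le> measure \<mu> {x. \<iota> x = i}" for i j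
    using incseq_le[OF s_incseq s_lim] .
  \<comment> \<open>Up to a null set, \<open>\<tau> x = j\<close> means that \<open>G x\<close> lies
    in the half-open interval from \<open>s i j\<close> to \<open>s i (Suc j)\<close>, where
    \<open>i = \<iota> x\<close>; the first interval starts at \<open>s i 0 = 0\<close>, below which
    \<open>G\<close> never falls.\<close>
  define \<tau> where "\<tau> x = (LEAST j. G x < s (\<iota> x) (Suc j))" for x
  have P[measurable]: "(\<lambda>x. G x < s (\<iota> x) (Suc j)) \<in> measurable borel (count_space UNIV)" for j
    by measurable
  have \<tau>_meas[measurable]: "\<tau> \<in> measurable borel (count_space UNIV)"
    unfolding \<tau>_def by measurable
  have "measure \<mu> {x. \<iota> x = i \<and> \<tau> x = j} = m i j" for i j
  proof -
    define E where "E c = {x. \<iota> x = i \<and> G x < c}" for c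
    have E_meas[measurable]: "E c \<in> sets borel" for c
      unfolding E_def by measurable
    \<comment> \<open>Where \<open>G x\<close> reaches the full mass of the cell, no partial sum
      exceeds it and \<open>LEAST\<close> returns an unspecified number. These points form the null
      set \<open>R\<close>.\<close>
    define R where "R = {x. \<iota> x = i} - E (measure \<mu> {x. \<iota> x = i})"
    have "measure \<mu> R = 0"
      unfolding R_def
      by (subst finite_measure_Diff) (auto simp: sets_eq E_def G_less)
    then have R_null: "R \<in> null_sets \<mu>"
      unfolding R_def by (auto simp: null_sets_def sets_eq emeasure_eq_measure)
    have \<tau>_iff: "\<tau> x = j \<longleftrightarrow> x \<in> E (s i (Suc j)) - E (s i j)" if x: "\<iota> x = i" "x \<notin> R" for x
    proof -
      have "G x < measure \<mu> {x. \<iota> x = i}"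
        using x by (auto simp: R_def E_def)
      then have "eventually (\<lambda>j. G x < s i j) sequentially"
        using s_lim[of i] by (metis order_tendstoD(1))
      then obtain k where "G x < s i k" by (auto simp: eventually_sequentially)
      then have "G x < s i (Suc k)" using s_mono[of i k] by linarith
      then have ex: "\<exists>k. G x < s (\<iota> x) (Suc k)" using x by auto
      have G0: "\<not> G x < s i 0"
        by (simp add: s_def G_def finite_borel_measure.cdf_nonneg[OF fbm] not_less)
      show ?thesis
      proof
        assume j: "\<tau> x = j"
        have 1: "G x < s i (Suc j)"
          using LeastI_ex[OF ex] j x unfolding \<tau>_def by simp
        have "\<not> G x < s i j"
        proof (cases j)
          case 0 then show ?thesis using G0 by simp
        next
          case (Suc k)
          then have "k < \<tau> x" using j by simp
          from not_less_Least[OF this[unfolded \<tau>_def]] show ?thesis using Suc x by simp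
        qed
        with 1 x show "x \<in> E (s i (Suc j)) - E (s i j)" by (auto simp: E_def)
      next
        assume a: "x \<in> E (s i (Suc j)) - E (s i j)"
        show "\<tau> x = j" unfolding \<tau>_def
        proof (rule Least_equality)
          show "G x < s (\<iota> x) (Suc j)" using a by (auto simp: E_def)
          fix k assume k: "G x < s (\<iota> x) (Suc k)"
          show "j \<le> k"
          proof (rule ccontr)
            assume "\<not> j \<le> k"
            then have "s i (Suc k) \<le> s i j" using incseqD[OF s_incseq, of "Suc k" j i] by simp
            then show False using k a x by (auto simp: E_def)
          qed
        qed
      qed
    qed
    have "measure \<mu> {x. \<iota> x = i \<and> \<tau> x = j} = measure \<mu> (E (s i (Suc j)) - E (s i j))"
    proof (rule measure_eq_AE)
      show "AE x in \<mu>. x \<in> {x. \<iota> x = i \<and> \<tau> x = j} \<longleftrightarrow> x \<in> E (s i (Suc j)) - E (s i j)"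
        using AE_not_in[OF R_null] by eventually_elim (use \<tau>_iff in \<open>auto simp: E_def\<close>)
    qed measurable
    also have "\<dots> = s i (Suc j) - s i j"
    proof -
      have "E (s i j) \<subseteq> E (s i (Suc j))" using s_mono[of i j] by (auto simp: E_def)
      then show ?thesis
        using G_less[OF s_nonneg s_le] by (subst finite_measure_Diff) (auto simp: sets_eq E_def)
    qed
    also have "\<dots> = m i j" by (simp add: s_def)
    finally show ?thesis .
  qed
  with \<tau>_meas show ?thesis using that by blast
qed

subsection \<open>Bochner spaces, couplings and pairings\<close>

lemma powr_add_le:
  fixes a b p :: real
  assumes "0 \<le> a" "0 \<le> b" "0 \<le> p"
  shows "(a + b) powr p \<le> 2 powr p * (a powr p + b powr p)"
proof -
  have "(a + b) powr p \<le> (2 * max a b) powr p"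
    using assms by (intro powr_mono2) auto
  also have "\<dots> = 2 powr p * max a b powr p"
    by (rule powr_mult)
  also have "max a b powr p \<le> a powr p + b powr p"
    by (auto simp: max_def)
  finally show ?thesis by simp
qed

lemma norm_add_powr_le:
  fixes x y :: "'a::real_normed_vector"
  assumes "0 \<le> p"
  shows "norm (x + y) powr p \<le> 2 powr p * (norm x powr p + norm y powr p)"
  using powr_mono2[OF assms norm_ge_zero norm_triangle_ineq[of x y]]
    powr_add_le[OF norm_ge_zero norm_ge_zero assms, of x y] by linarith

text \<open>A crude form of Young's inequality, obtained by replacing the smaller of
  \<open>a\<close> and \<open>b\<close> by the larger. It serves to pair a derivative of growth
  \<open>p - 1\<close> with a direction in \<open>L\<^sup>p\<close>.\<close>

lemma powr_minus_one_mult_le: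
  fixes a b p :: real
  assumes "0 \<le> a" "0 \<le> b" "1 \<le> p"
  shows "a powr (p - 1) * b \<le> a powr p + b powr p"
proof -
  have eq: "c powr (p - 1) * c = c powr p" if "0 \<le> c" for c :: real
    using that by (cases "c = 0") (auto simp: powr_diff)
  show ?thesis
  proof (cases "b \<le> a")
    case True
    then have "a powr (p - 1) * b \<le> a powr (p - 1) * a"
      by (intro mult_left_mono) auto
    then show ?thesis using eq[OF assms(1)] powr_ge_zero[of b p] by linarith
  next
    case False
    then have "a powr (p - 1) * b \<le> b powr (p - 1) * b"
      using assms by (intro mult_right_mono powr_mono2) auto
    then show ?thesis using eq[OF assms(2)] powr_ge_zero[of a p] by linarith
  qed
qed

lemma le_one_plus_powr:
  fixes a p :: real
  assumes "0 \<le> a" "1 \<le> p"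
  shows "a \<le> 1 + a powr p"
proof (cases "a \<le> 1")
  case False
  then have "a powr 1 \<le> a powr p" using assms by (intro powr_mono) auto
  then show ?thesis using False by simp
qed (use powr_ge_zero[of a p] in linarith)

section \<open>Linear structure and norm of the Bochner spaces\<close>

lemma Lspace_ereal_iff:
  fixes g :: "'a \<Rightarrow> 'b::{real_normed_vector, second_countable_topology}"
  shows "g \<in> Lspace (ereal p) M \<longleftrightarrow>
    g \<in> borel_measurable M \<and> integrable M (\<lambda>x. norm (g x) powr p)"
proof -
  obtain A :: "'b set" where A: "countable A" "\<And>X. open X \<Longrightarrow> X \<noteq> {} \<Longrightarrow> \<exists>d\<in>A. d \<in> X"
    using countable_dense_setE by metis
  \<comment> \<open>The closure of a countable dense set is the whole space, which supplies the
    separable range demanded by \<open>strongly_measurable\<close>.\<close>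
  have "closure A = UNIV"
  proof -
    have "\<exists>d\<in>A. d \<in> - closure A" if "- closure A \<noteq> {}"
      using A(2)[OF _ that] by auto
    then show ?thesis using closure_subset[of A] by blast
  qed
  then show ?thesis
    using A(1) by (auto simp: Lspace_def strongly_measurable_def)
qed

lemma Lspace_add:
  fixes g h :: "'a \<Rightarrow> 'b::{banach, second_countable_topology}"
  assumes p: "1 \<le> p" and "g \<in> Lspace (ereal p) M" "h \<in> Lspace (ereal p) M"
  shows "(\<lambda>x. g x + h x) \<in> Lspace (ereal p) M"
proof -
  have [measurable]: "g \<in> borel_measurable M" "h \<in> borel_measurable M"
    and int: "integrable M (\<lambda>x. norm (g x) powr p)" "integrable M (\<lambda>x. norm (h x) powr p)"
    using assms by (auto simp: Lspace_ereal_iff)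
  have "integrable M (\<lambda>x. norm (g x + h x) powr p)"
    by (rule Bochner_Integration.integrable_bound[OF
          integrable_mult_right[OF Bochner_Integration.integrable_add[OF int], of "2 powr p"]])
       (use p norm_add_powr_le[of p] in auto)
  then show ?thesis by (simp add: Lspace_ereal_iff)
qed

lemma Lspace_scaleR:
  fixes g :: "'a \<Rightarrow> 'b::{banach, second_countable_topology}"
  assumes "g \<in> Lspace (ereal p) M"
  shows "(\<lambda>x. c *\<^sub>R g x) \<in> Lspace (ereal p) M"
  using assms by (auto simp: Lspace_ereal_iff powr_mult)

lemma Lspace_diff:
  fixes g h :: "'a \<Rightarrow> 'b::{banach, second_countable_topology}"
  assumes "1 \<le> p" and "g \<in> Lspace (ereal p) M" "h \<in> Lspace (ereal p) M"
  shows "(\<lambda>x. g x - h x) \<in> Lspace (ereal p) M"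
  using Lspace_add[OF assms(1,2) Lspace_scaleR[OF assms(3), of "-1"]] by simp

lemma (in finite_measure) Lspace_bounded:
  fixes g :: "'a \<Rightarrow> 'b::{banach, second_countable_topology}"
  assumes [measurable]: "g \<in> borel_measurable M" and "\<And>x. norm (g x) \<le> K" "0 \<le> p"
  shows "g \<in> Lspace (ereal p) M"
proof -
  have "integrable M (\<lambda>x. norm (g x) powr p)"
    by (rule integrable_const_bound[where B="K powr p"]) (use assms in \<open>auto intro!: powr_mono2\<close>)
  then show ?thesis by (simp add: Lspace_ereal_iff)
qed

lemma (in finite_measure) Lspace_integrable:
  fixes g :: "'a \<Rightarrow> 'b::{banach, second_countable_topology}"
  assumes "1 \<le> p" "g \<in> Lspace (ereal p) M"
  shows "integrable M g"
proof -
  have [measurable]: "g \<in> borel_measurable M" and int: "integrable M (\<lambda>x. norm (g x) powr p)"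
    using assms by (auto simp: Lspace_ereal_iff)
  show ?thesis
    by (rule Bochner_Integration.integrable_bound[OF Bochner_Integration.integrable_add[OF
            integrable_const[of 1] int]])
       (use le_one_plus_powr[OF norm_ge_zero assms(1)] in auto)
qed

lemma Lnorm_nonneg: "0 \<le> Lnorm p M g"
  by (simp add: Lnorm_def)

lemma Lnorm_powr: "0 < p \<Longrightarrow> Lnorm p M g powr p = (\<integral>x. norm (g x) powr p \<partial>M)"
  by (simp add: Lnorm_def powr_powr)

lemma Lnorm_scaleR:
  fixes g :: "'a \<Rightarrow> 'b::real_normed_vector"
  assumes "0 < p"
  shows "Lnorm p M (\<lambda>x. c *\<^sub>R g x) = \<bar>c\<bar> * Lnorm p M g"
  using assms by (simp add: Lnorm_def powr_mult powr_powr)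

lemma Lnorm_le_iff:
  assumes "0 < p" "0 \<le> c"
  shows "Lnorm p M g \<le> c \<longleftrightarrow> (\<integral>x. norm (g x) powr p \<partial>M) \<le> c powr p"
proof -
  have "Lnorm p M g \<le> c \<longleftrightarrow> Lnorm p M g powr p \<le> c powr p"
    using assms powr_mono2[of p "Lnorm p M g" c] powr_less_mono2[of p c "Lnorm p M g"]
      Lnorm_nonneg[of p M g] by linarith
  then show ?thesis using assms by (simp add: Lnorm_powr)
qed

lemma Lnorm_eq_0_AE:
  fixes g :: "'a \<Rightarrow> 'b::{banach, second_countable_topology}"
  assumes "0 < p" "g \<in> Lspace (ereal p) M" "Lnorm p M g = 0"
  shows "AE x in M. g x = 0"
proof -
  have "(\<integral>x. norm (g x) powr p \<partial>M) = 0"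
    using Lnorm_powr[of p M g] assms by simp
  then have "AE x in M. norm (g x) powr p = 0"
    using assms by (subst (asm) integral_nonneg_eq_0_iff_AE) (auto simp: Lspace_ereal_iff)
  then show ?thesis by auto
qed

lemma (in prob_space) distr_in_Prob_p_iff:
  assumes [measurable]: "X \<in> borel_measurable M"
  shows "distr M borel X \<in> Prob_p p \<longleftrightarrow> X \<in> Lspace (ereal p) M"
  by (simp add: Prob_p_def prob_space_distr Lspace_ereal_iff integrable_distr_eq)

section \<open>Couplings given by pairs of random variables\<close>

lemma Wasserstein_le:
  assumes "\<pi> \<in> couplings \<mu> \<nu>"
  shows "Wasserstein p \<mu> \<nu> \<le> (\<integral>z. norm (fst z - snd z) powr p \<partial>\<pi>) powr (1 / p)"
  unfolding Wasserstein_def by (rule cINF_lower[OF _ assms]) (auto intro!: bdd_belowI2[of _ 0])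

text \<open>The joint law of \<open>X\<close> and \<open>Y\<close> is one of the couplings over
  which the infimum runs.\<close>

lemma (in prob_space) Wasserstein_distr_le:
  assumes [measurable]: "X \<in> borel_measurable M" "Y \<in> borel_measurable M"
  shows "Wasserstein p (distr M borel X) (distr M borel Y) \<le> Lnorm p M (\<lambda>\<omega>. X \<omega> - Y \<omega>)"
proof -
  let ?\<pi> = "distr M (borel \<Otimes>\<^sub>M borel) (\<lambda>\<omega>. (X \<omega>, Y \<omega>))"
  have "?\<pi> \<in> couplings (distr M borel X) (distr M borel Y)"
    by (auto simp: couplings_def prob_space_distr distr_distr comp_def)
  from Wasserstein_le[OF this, of p] show ?thesis
    by (simp add: Lnorm_def integral_distr)
qed

section \<open>Measurability, growth and discretization of the pairing\<close>

lemma blinfun_apply_measurable: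
  fixes D :: "'a \<Rightarrow> 'b::{real_normed_vector, second_countable_topology} \<Rightarrow>\<^sub>L 'c::{real_normed_vector, second_countable_topology}"
  assumes [measurable]: "D \<in> borel_measurable M" and g: "g \<in> borel_measurable M"
  shows "(\<lambda>x. blinfun_apply (D x) (g x)) \<in> borel_measurable M"
proof -
  \<comment> \<open>The space of operators need not be separable, so measurability of the pair
    \<open>(D, g)\<close> into the Borel sets of the product cannot be taken for granted. For a
    fixed vector, however, evaluation is continuous in the operator, and approximating
    \<open>g\<close> by functions with finitely many values reduces everything to that case.\<close>
  obtain s where s: "\<And>i. simple_function M (s i)" "\<And>x. x \<in> space M \<Longrightarrow> (\<lambda>i. s i x) \<longlonglongrightarrow> g x"
    using borel_measurable_implies_sequence_metric[OF g, of 0] by metis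
  have ap[measurable]: "(\<lambda>x. blinfun_apply (D x) v) \<in> borel_measurable M" for v
    by (rule measurable_compose[OF assms(1)]) (intro borel_measurable_continuous_onI continuous_intros)
  show ?thesis
  proof (rule borel_measurable_LIMSEQ_metric)
    show "(\<lambda>x. blinfun_apply (D x) (s i x)) \<in> borel_measurable M" for i
    proof (rule measurable_compose_countable'[where f="\<lambda>v x. blinfun_apply (D x) v" and I="s i ` space M"])
      show "s i \<in> M \<rightarrow>\<^sub>M count_space (s i ` space M)"
        using measurable_simple_function[OF s(1)] by (rule measurable_count_space_extend[rotated 2]) auto
      show "countable (s i ` space M)"
        using s(1)[of i] by (auto simp: simple_function_def intro: countable_finite)
    qed auto
    show "(\<lambda>i. blinfun_apply (D x) (s i x)) \<longlonglongrightarrow> blinfun_apply (D x) (g x)" if "x \<in> space M" for x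
      using s(2)[OF that] by (intro tendsto_intros)
  qed
qed

text \<open>Brings the case \<open>p = 1\<close>, where the bound is constant, under the formula for
  \<open>p > 1\<close>, so that later estimates need no distinction.\<close>

lemma growth_bound_le:
  assumes "growth_bound p C V" "1 \<le> p" "0 \<le> C"
  shows "norm (V x) \<le> C * (1 + norm x powr (p - 1))"
proof (cases "p > 1")
  case True
  then have "real_of_ereal (ereal p / conj_exponent p) = p - 1"
    by (simp add: conj_exponent_def)
  with assms(1) True show ?thesis by (simp add: growth_bound_def)
next
  case False
  then have "norm (V x) \<le> C * 1"
    using assms(1) by (simp add: growth_bound_def)
  also have "\<dots> \<le> C * (1 + norm x powr (p - 1))"
    using assms(3) by (intro mult_left_mono) auto
  finally show ?thesis .
qed

text \<open>Each of the two terms of the growth bound contributes one \<open>norm y powr p\<close>,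
  whence the factor 2. On a finite measure space the right side is integrable along any two
  functions in \<open>L\<^sup>p\<close>, so it can dominate the pairings.\<close>

lemma growth_bound_pairing_le:
  assumes "growth_bound p C V" "1 \<le> p" "0 \<le> C"
  shows "norm (V x) * norm y \<le> C * (1 + norm x powr p + 2 * norm y powr p)"
proof -
  have "norm (V x) * norm y \<le> C * (1 + norm x powr (p - 1)) * norm y"
    using growth_bound_le[OF assms] by (intro mult_right_mono) auto
  also have "\<dots> = C * (norm y + norm x powr (p - 1) * norm y)"
    by (simp add: algebra_simps)
  also have "\<dots> \<le> C * ((1 + norm y powr p) + (norm x powr p + norm y powr p))"
    using assms by (intro mult_left_mono add_mono le_one_plus_powr powr_minus_one_mult_le) auto
  finally show ?thesis by (simp add: algebra_simps)
qed

lemma (in finite_measure) growth_bound_integrable: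
  fixes X Z :: "'a \<Rightarrow> 'b::{banach, second_countable_topology}"
  assumes V: "continuous_on UNIV V" "growth_bound p C V" and p: "1 \<le> p" "0 \<le> C"
    and X: "X \<in> Lspace (ereal p) M" and Z: "Z \<in> Lspace (ereal p) M"
  shows "integrable M (\<lambda>\<omega>. blinfun_apply (V (X \<omega>)) (Z \<omega>))"
    and "integrable M (\<lambda>\<omega>. norm (V (X \<omega>)))"
proof -
  have [measurable]: "X \<in> borel_measurable M" "Z \<in> borel_measurable M"
    "V \<in> borel_measurable borel"
    using X Z V(1) by (auto simp: Lspace_ereal_iff intro: borel_measurable_continuous_onI)
  have m[measurable]: "(\<lambda>\<omega>. blinfun_apply (V (X \<omega>)) (Z \<omega>)) \<in> borel_measurable M"
    by (rule blinfun_apply_measurable) measurable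
  have int: "integrable M (\<lambda>\<omega>. C * (1 + norm (X \<omega>) powr p + 2 * norm (Z \<omega>) powr p))"
    using X Z by (auto simp: Lspace_ereal_iff)
  show "integrable M (\<lambda>\<omega>. blinfun_apply (V (X \<omega>)) (Z \<omega>))"
  proof (rule Bochner_Integration.integrable_bound[OF int m], rule AE_I2)
    fix \<omega>
    show "norm (blinfun_apply (V (X \<omega>)) (Z \<omega>)) \<le> norm (C * (1 + norm (X \<omega>) powr p + 2 * norm (Z \<omega>) powr p))"
      using norm_blinfun[of "V (X \<omega>)" "Z \<omega>"] growth_bound_pairing_le[OF V(2) p, of "X \<omega>" "Z \<omega>"]
      by (auto intro: order_trans)
  qed
  have int1: "integrable M (\<lambda>\<omega>. C * (3 + norm (X \<omega>) powr p))"
    using X by (auto simp: Lspace_ereal_iff)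
  show "integrable M (\<lambda>\<omega>. norm (V (X \<omega>)))"
  proof (rule Bochner_Integration.integrable_bound[OF int1], measurable, rule AE_I2)
    fix \<omega>
    \<comment> \<open>The factor 1 plays the part of \<open>b\<close> in
      \<open>powr_minus_one_mult_le\<close>.\<close>
    have "norm (V (X \<omega>)) \<le> C * (1 + norm (X \<omega>) powr (p - 1) * 1)"
      using growth_bound_le[OF V(2) p] by simp
    also have "\<dots> \<le> C * (1 + (norm (X \<omega>) powr p + 1 powr p))"
      using p by (intro mult_left_mono add_left_mono powr_minus_one_mult_le) auto
    also have "\<dots> \<le> C * (3 + norm (X \<omega>) powr p)"
      using p by (intro mult_left_mono) auto
    finally show "norm (norm (V (X \<omega>))) \<le> norm (C * (3 + norm (X \<omega>) powr p))" by auto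
  qed
qed

text \<open>Since \<open>V\<close> need not be uniformly continuous, the last clause is not a matter of taking \<open>\<delta>\<close> small;
  it comes from covering by countably many open sets on which both oscillations are small.\<close>
lemma exists_discretization:
  fixes V :: "'b::{metric_space, second_countable_topology} \<Rightarrow> 'c::metric_space"
  assumes V: "continuous_on UNIV V" and \<delta>: "0 < \<delta>"
  obtains \<iota> :: "'b \<Rightarrow> nat" and a :: "nat \<Rightarrow> 'b"
  where "\<iota> \<in> measurable borel (count_space UNIV)"
    "\<And>x. dist (a (\<iota> x)) x < \<delta>" "\<And>x. dist (V (a (\<iota> x))) (V x) < \<delta>"
proof -
  define S where "S x = {y. dist x y < \<delta> \<and> dist (V x) (V y) < \<delta>}" for x
  have S_open: "open (S x)" for x
  proof -
    have "open {y. dist x y < \<delta>}" "open {y. dist (V x) (V y) < \<delta>}"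
      using V by (auto intro!: open_Collect_less continuous_intros)
    then show ?thesis unfolding S_def by (rule open_Collect_conj)
  qed
  obtain F where F: "F \<subseteq> range S" "countable F" "\<Union>F = \<Union>(range S)"
    using Lindelof[of "range S"] S_open by blast
  have cover: "\<Union>(range S) = UNIV"
    using \<delta> by (auto simp: S_def)
  obtain C where C: "countable C" "F = S ` C"
    using F(1,2) countable_subset_image[of F S UNIV] by auto
  have "C \<noteq> {}" using C F cover by auto
  define a where "a = from_nat_into C"
  have rng: "range a = C"
    unfolding a_def using \<open>C \<noteq> {}\<close> C(1) by (rule range_from_nat_into)
  \<comment> \<open>Taking the first covering set turns the overlapping cover into a partition with
    measurable cells.\<close>
  define \<iota> where "\<iota> x = (LEAST n. x \<in> S (a n))" for x
  have ex: "\<exists>n. x \<in> S (a n)" for x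
    using F(3) cover C rng by (metis (mono_tags, opaque_lifting) UNIV_I UN_E rangeE)
  have "x \<in> S (a (\<iota> x))" for x
    unfolding \<iota>_def using LeastI_ex[OF ex] .
  moreover have [measurable]: "S (a n) \<in> sets borel" for n using S_open by simp
  have "\<iota> \<in> measurable borel (count_space UNIV)"
    unfolding \<iota>_def by measurable
  ultimately show ?thesis using that[of \<iota> a] by (auto simp: S_def)
qed

text \<open>Dominated convergence with a majorant that moves by \<open>R n\<close>: after
  subtracting \<open>R n\<close> and truncating at 0 the majorant is fixed. Convergence in
  \<open>L\<^sup>p\<close> provides just such a majorant, since \<open>norm (x + h) powr p\<close>
  is bounded by a multiple of \<open>norm x powr p\<close> plus an error in \<open>h\<close> that
  vanishes in the mean.\<close>

lemma tendsto_integral_dominated_plus_null: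
  fixes g R :: "nat \<Rightarrow> 'a \<Rightarrow> real"
  assumes g: "\<And>n. integrable M (g n)" and R: "\<And>n. integrable M (R n)" and H: "integrable M H"
    and nonneg: "\<And>n x. 0 \<le> g n x" "\<And>n x. 0 \<le> R n x"
    and bound: "\<And>n x. g n x \<le> H x + R n x"
    and lim: "AE x in M. (\<lambda>n. g n x) \<longlonglongrightarrow> 0"
    and R_lim: "(\<lambda>n. \<integral>x. R n x \<partial>M) \<longlonglongrightarrow> 0"
  shows "(\<lambda>n. \<integral>x. g n x \<partial>M) \<longlonglongrightarrow> 0"
proof -
  define k where "k n x = max 0 (g n x - R n x)" for n x
  have k_int: "integrable M (k n)" for n
    unfolding k_def by (intro integrable_max integrable_zero Bochner_Integration.integrable_diff g R)
  have "(\<lambda>n. \<integral>x. k n x \<partial>M) \<longlonglongrightarrow> (\<integral>x. 0 \<partial>M)"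
  \<comment> \<open>The absolute value appears because \<open>H\<close> is not assumed to be
    nonnegative.\<close>
  proof (rule integral_dominated_convergence[where w="\<lambda>x. \<bar>H x\<bar>"])
    show "AE x in M. (\<lambda>n. k n x) \<longlonglongrightarrow> 0"
      using lim
    proof eventually_elim
      case (elim x)
      show ?case
        by (rule tendsto_sandwich[OF _ _ tendsto_const elim])
           (use nonneg in \<open>auto simp: k_def intro!: always_eventually\<close>)
    qed
    show "AE x in M. norm (k n x) \<le> \<bar>H x\<bar>" for n
    proof (rule AE_I2)
      fix x
      show "norm (k n x) \<le> \<bar>H x\<bar>"
        using bound[of n x] by (auto simp: k_def max_def)
    qed
  qed (use k_int H in auto)
  then have up: "(\<lambda>n. (\<integral>x. k n x \<partial>M) + (\<integral>x. R n x \<partial>M)) \<longlonglongrightarrow> 0"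
    using tendsto_add[OF _ R_lim] by simp
  show ?thesis
  proof (rule tendsto_sandwich[OF _ _ tendsto_const up])
    show "\<forall>\<^sub>F n in sequentially. 0 \<le> (\<integral>x. g n x \<partial>M)"
      using nonneg by simp
    have "(\<integral>x. g n x \<partial>M) \<le> (\<integral>x. k n x + R n x \<partial>M)" for n
      by (intro integral_mono g Bochner_Integration.integrable_add k_int R) (auto simp: k_def)
    then show "\<forall>\<^sub>F n in sequentially. (\<integral>x. g n x \<partial>M) \<le> (\<integral>x. k n x \<partial>M) + (\<integral>x. R n x \<partial>M)"
      using k_int R by simp
  qed
qed

subsection \<open>Differentiability of the lift\<close>

text \<open>Multiplies out the quotient of the definition and replaces the derivative by its
  continuous version \<open>V\<close>. Directions of norm 0, which the definition leaves out, are
  included, so that later uses need not check for them.\<close>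

lemma L_derivative_estimate:
  fixes f :: "'b::{banach, second_countable_topology} measure \<Rightarrow> real"
  assumes L: "has_L_derivative p f \<mu> D" and sets_eq: "sets \<mu> = sets borel"
    and V: "continuous_on UNIV V" "AE x in \<mu>. V x = D x" and p: "1 \<le> p" and e: "0 < e"
  obtains d where "0 < d" "\<And>\<phi>. \<phi> \<in> tangent p \<mu> \<Longrightarrow> Lnorm p \<mu> \<phi> < d \<Longrightarrow>
     \<bar>f (distr \<mu> borel (\<lambda>x. x + \<phi> x)) - f \<mu> - (\<integral>x. blinfun_apply (V x) (\<phi> x) \<partial>\<mu>)\<bar> \<le> e * Lnorm p \<mu> \<phi>"
proof -
  note [measurable_cong] = sets_eq
  have [measurable]: "V \<in> borel_measurable borel"
    using V(1) by (rule borel_measurable_continuous_onI)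
  have [measurable]: "D \<in> borel_measurable \<mu>"
    using L by (auto simp: has_L_derivative_def has_intrinsic_derivative_def Lspace_def strongly_measurable_def)
  have pairing: "(\<integral>x. blinfun_apply (V x) (\<phi> x) \<partial>\<mu>) = dir_derivative f \<mu> \<phi>" if \<phi>: "\<phi> \<in> tangent p \<mu>" for \<phi>
  proof -
    have [measurable]: "\<phi> \<in> borel_measurable \<mu>"
      using \<phi> by (simp add: Lspace_ereal_iff)
    have "(\<integral>x. blinfun_apply (V x) (\<phi> x) \<partial>\<mu>) = (\<integral>x. blinfun_apply (D x) (\<phi> x) \<partial>\<mu>)"
      by (rule integral_cong_AE) (use V(2) in \<open>auto intro!: blinfun_apply_measurable\<close>)
    then show ?thesis using L \<phi> by (auto simp: has_L_derivative_def has_intrinsic_derivative_def)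
  qed
  obtain d where d: "0 < d" "\<And>\<phi>. \<phi> \<in> tangent p \<mu> \<Longrightarrow> 0 < Lnorm p \<mu> \<phi> \<Longrightarrow> Lnorm p \<mu> \<phi> < d \<Longrightarrow>
      \<bar>f (distr \<mu> borel (\<lambda>x. x + \<phi> x)) - f \<mu> - dir_derivative f \<mu> \<phi>\<bar> / Lnorm p \<mu> \<phi> < e"
    using L e unfolding has_L_derivative_def by meson
  have "\<bar>f (distr \<mu> borel (\<lambda>x. x + \<phi> x)) - f \<mu> - (\<integral>x. blinfun_apply (V x) (\<phi> x) \<partial>\<mu>)\<bar> \<le> e * Lnorm p \<mu> \<phi>"
    if \<phi>: "\<phi> \<in> tangent p \<mu>" "Lnorm p \<mu> \<phi> < d" for \<phi>
  proof (cases "Lnorm p \<mu> \<phi> = 0")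
    \<comment> \<open>A direction of norm 0 vanishes almost everywhere, so it leaves the law
      unchanged and its pairing is 0.\<close>
    case True
    have [measurable]: "\<phi> \<in> borel_measurable \<mu>"
      using \<phi> by (simp add: Lspace_ereal_iff)
    have 0: "AE x in \<mu>. \<phi> x = 0"
      using Lnorm_eq_0_AE[OF _ \<phi>(1) True] p by simp
    then have "distr \<mu> borel (\<lambda>x. x + \<phi> x) = distr \<mu> borel (\<lambda>x. x)"
      by (intro distr_cong_AE) auto
    also have "\<dots> = \<mu>" by (rule distr_id2) (simp add: sets_eq)
    finally have "distr \<mu> borel (\<lambda>x. x + \<phi> x) = \<mu>" .
    moreover have "(\<integral>x. blinfun_apply (V x) (\<phi> x) \<partial>\<mu>) = (\<integral>x. 0 \<partial>\<mu>)"
      by (rule integral_cong_AE) (use 0 in \<open>auto intro!: blinfun_apply_measurable simp: blinfun.zero_right\<close>)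
    ultimately show ?thesis using True by simp
  next
    case False
    then have "0 < Lnorm p \<mu> \<phi>" using Lnorm_nonneg[of p \<mu> \<phi>] by linarith
    then show ?thesis
      using d(2)[OF \<phi>(1) _ \<phi>(2)] pairing[OF \<phi>(1)] by (simp add: divide_less_eq)
  qed
  with d(1) show ?thesis using that by blast
qed

text \<open>\<open>\<alpha>\<close> and \<open>\<beta>\<close> round to the centres of cells, and
  \<open>\<alpha>\<close> respects \<open>V\<close> as well. \<open>T\<close> takes centres
  \<open>b j\<close> too, but the splitting index \<open>\<tau>\<close>, not the cell containing
  \<open>x\<close>, decides which one: within one cell of \<open>X\<close> it reproduces the
  conditional law of the rounded \<open>Y\<close>.\<close>

lemma (in prob_space) exists_discrete_transport:
  fixes X Y :: "'a \<Rightarrow> 'b::{banach, second_countable_topology}" and V :: "'b \<Rightarrow> 'c::metric_space"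
  assumes X[measurable]: "X \<in> borel_measurable M" and Y[measurable]: "Y \<in> borel_measurable M"
    and no_atoms: "\<And>x. measure (distr M borel X) {x} = 0"
    and V: "continuous_on UNIV V" and \<delta>: "0 < \<delta>"
  obtains T \<alpha> \<beta> :: "'b \<Rightarrow> 'b"
  where "T \<in> borel_measurable borel" "\<alpha> \<in> borel_measurable borel" "\<beta> \<in> borel_measurable borel"
    "\<And>x. dist (\<alpha> x) x < \<delta>" "\<And>x. dist (V (\<alpha> x)) (V x) < \<delta>" "\<And>x. dist (\<beta> x) x < \<delta>"
    "distr (distr M borel X) (borel \<Otimes>\<^sub>M borel) (\<lambda>x. (\<alpha> x, T x)) =
      distr M (borel \<Otimes>\<^sub>M borel) (\<lambda>\<omega>. (\<alpha> (X \<omega>), \<beta> (Y \<omega>)))"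
proof -
  let ?\<mu> = "distr M borel X"
  obtain \<iota> :: "'b \<Rightarrow> nat" and a where \<iota>[measurable]: "\<iota> \<in> measurable borel (count_space UNIV)"
    and a: "\<And>x. dist (a (\<iota> x)) x < \<delta>" "\<And>x. dist (V (a (\<iota> x))) (V x) < \<delta>"
    using exists_discretization[OF V \<delta>] by blast
  \<comment> \<open>For \<open>Y\<close> only the distance matters, so the identity takes the place
    of \<open>V\<close>.\<close>
  obtain \<kappa> :: "'b \<Rightarrow> nat" and b :: "nat \<Rightarrow> 'b" where \<kappa>[measurable]: "\<kappa> \<in> measurable borel (count_space UNIV)"
    and b: "\<And>x. dist (b (\<kappa> x)) x < \<delta>"
    using exists_discretization[OF continuous_on_id \<delta>] by metis
  define m where "m i j = measure M {\<omega>\<in>space M. \<iota> (X \<omega>) = i \<and> \<kappa> (Y \<omega>) = j}" for i j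
  have m_sums: "m i sums measure ?\<mu> {x. \<iota> x = i}" for i
  proof -
    have "(\<lambda>j. measure M {\<omega>\<in>space M. \<iota> (X \<omega>) = i \<and> \<kappa> (Y \<omega>) = j}) sums
        measure M (\<Union>j. {\<omega>\<in>space M. \<iota> (X \<omega>) = i \<and> \<kappa> (Y \<omega>) = j})"
      by (rule finite_measure_UNION) (auto simp: disjoint_family_on_def)
    moreover have "(\<Union>j. {\<omega>\<in>space M. \<iota> (X \<omega>) = i \<and> \<kappa> (Y \<omega>) = j}) = X -` {x. \<iota> x = i} \<inter> space M"
      by auto
    moreover have "measure ?\<mu> {x. \<iota> x = i} = measure M (X -` {x. \<iota> x = i} \<inter> space M)"
      by (rule measure_distr) measurable
    ultimately show ?thesis by (simp add: m_def[abs_def])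
  qed
  have m_nonneg: "0 \<le> m i j" for i j
    by (simp add: m_def)
  have fin: "finite_measure ?\<mu>"
    using prob_space_distr[OF X] by (simp add: prob_space_def)
  obtain \<tau> :: "'b \<Rightarrow> nat" where \<tau>[measurable]: "\<tau> \<in> measurable borel (count_space UNIV)"
    and \<tau>_eq: "\<And>i j. measure ?\<mu> {x. \<iota> x = i \<and> \<tau> x = j} = m i j"
    using exists_splitting_map[OF fin sets_distr no_atoms \<iota> m_nonneg m_sums] by blast
  have pair1[measurable]: "(\<lambda>x. (\<iota> x, \<tau> x)) \<in> borel \<rightarrow>\<^sub>M count_space UNIV"
    by measurable
  have pair2[measurable]: "(\<lambda>\<omega>. (\<iota> (X \<omega>), \<kappa> (Y \<omega>))) \<in> M \<rightarrow>\<^sub>M count_space UNIV"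
    by measurable
  \<comment> \<open>Both index pairs live on a countable space, where equality of laws can be
    checked on points; the centres are attached afterwards through \<open>?G\<close>.\<close>
  have eq: "distr ?\<mu> (count_space UNIV) (\<lambda>x. (\<iota> x, \<tau> x)) = distr M (count_space UNIV) (\<lambda>\<omega>. (\<iota> (X \<omega>), \<kappa> (Y \<omega>)))"
    (is "?P = ?Q")
  proof (rule measure_eqI_countable[where A=UNIV])
    fix ij :: "nat \<times> nat"
    obtain i j where ij: "ij = (i, j)" by (cases ij)
    interpret \<mu>: finite_measure ?\<mu> by (rule fin)
    have "emeasure ?P {ij} = emeasure ?\<mu> {x. \<iota> x = i \<and> \<tau> x = j}"
      by (subst emeasure_distr) (auto simp: ij vimage_def)
    also have "\<dots> = ennreal (m i j)"
      by (simp add: \<mu>.emeasure_eq_measure \<tau>_eq)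
    also have "\<dots> = emeasure M {\<omega>\<in>space M. \<iota> (X \<omega>) = i \<and> \<kappa> (Y \<omega>) = j}"
      by (simp add: m_def emeasure_eq_measure)
    also have "\<dots> = emeasure ?Q {ij}"
      by (subst emeasure_distr) (auto simp: ij intro!: arg_cong[where f="emeasure M"])
    finally show "emeasure ?P {ij} = emeasure ?Q {ij}" .
  qed auto
  let ?G = "\<lambda>(i, j). (a i, b j)"
  have "distr ?P (borel \<Otimes>\<^sub>M borel) ?G = distr ?Q (borel \<Otimes>\<^sub>M borel) ?G"
    by (simp add: eq)
  moreover have "?G \<in> count_space UNIV \<rightarrow>\<^sub>M borel \<Otimes>\<^sub>M borel"
    by (auto simp: measurable_count_space_eq1 space_pair_measure)
  ultimately have law: "distr ?\<mu> (borel \<Otimes>\<^sub>M borel) (\<lambda>x. (a (\<iota> x), b (\<tau> x))) =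
      distr M (borel \<Otimes>\<^sub>M borel) (\<lambda>\<omega>. (a (\<iota> (X \<omega>)), b (\<kappa> (Y \<omega>))))"
    by (subst (asm) (1 2) distr_distr) (auto simp: comp_def)
  have ab: "a \<in> count_space UNIV \<rightarrow>\<^sub>M borel" "b \<in> count_space UNIV \<rightarrow>\<^sub>M borel" by auto
  show ?thesis
    by (rule that[of "\<lambda>x. b (\<tau> x)" "\<lambda>x. a (\<iota> x)" "\<lambda>x. b (\<kappa> x)"])
       (use law a b measurable_compose[OF \<iota> ab(1)] measurable_compose[OF \<tau> ab(2)] measurable_compose[OF \<kappa> ab(2)] in auto)
qed

text \<open>Telescoping: the change of the operator is measured against \<open>Z'\<close>, the
  change of the direction against \<open>V (X \<omega>)\<close>. Each error is a uniform bound times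
  a first moment, which is why closeness is required pointwise.\<close>

lemma (in prob_space) pairing_perturbation_le:
  fixes X X' :: "'a \<Rightarrow> 'b::{banach, second_countable_topology}"
  assumes V: "continuous_on UNIV V" "growth_bound p C V" and p: "1 \<le> p" "0 \<le> C"
    and L: "X \<in> Lspace (ereal p) M" "Z \<in> Lspace (ereal p) M" "X' \<in> Lspace (ereal p) M" "Z' \<in> Lspace (ereal p) M"
    and close: "\<And>\<omega>. norm (V (X' \<omega>) - V (X \<omega>)) \<le> r" "\<And>\<omega>. norm (Z' \<omega> - Z \<omega>) \<le> s"
  shows "\<bar>(\<integral>\<omega>. blinfun_apply (V (X \<omega>)) (Z \<omega>) \<partial>M) - (\<integral>\<omega>. blinfun_apply (V (X' \<omega>)) (Z' \<omega>) \<partial>M)\<bar>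
    \<le> r * (\<integral>\<omega>. norm (Z' \<omega>) \<partial>M) + s * (\<integral>\<omega>. norm (V (X \<omega>)) \<partial>M)"
proof -
  have int: "integrable M (\<lambda>\<omega>. blinfun_apply (V (X \<omega>)) (Z \<omega>))"
    "integrable M (\<lambda>\<omega>. blinfun_apply (V (X' \<omega>)) (Z' \<omega>))"
    "integrable M (\<lambda>\<omega>. norm (V (X \<omega>)))"
    using growth_bound_integrable(1)[OF V p L(1,2)] growth_bound_integrable(1)[OF V p L(3,4)]
      growth_bound_integrable(2)[OF V p L(1,2)] by auto
  have intZ: "integrable M (\<lambda>\<omega>. norm (Z' \<omega>))"
    using Lspace_integrable[OF p(1) L(4)] by (rule integrable_norm)
  have "\<bar>\<integral>\<omega>. blinfun_apply (V (X \<omega>)) (Z \<omega>) - blinfun_apply (V (X' \<omega>)) (Z' \<omega>) \<partial>M\<bar>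
    \<le> (\<integral>\<omega>. norm (blinfun_apply (V (X \<omega>)) (Z \<omega>) - blinfun_apply (V (X' \<omega>)) (Z' \<omega>)) \<partial>M)"
    unfolding real_norm_def[symmetric] by (rule integral_norm_bound)
  also have "\<dots> \<le> (\<integral>\<omega>. r * norm (Z' \<omega>) + s * norm (V (X \<omega>)) \<partial>M)"
  proof (rule integral_mono)
    fix \<omega>
    have "blinfun_apply (V (X \<omega>)) (Z \<omega>) - blinfun_apply (V (X' \<omega>)) (Z' \<omega>)
        = - (blinfun_apply (V (X' \<omega>) - V (X \<omega>)) (Z' \<omega>) + blinfun_apply (V (X \<omega>)) (Z' \<omega> - Z \<omega>))"
      by (simp add: blinfun.diff_left blinfun.diff_right)
    then have "norm (blinfun_apply (V (X \<omega>)) (Z \<omega>) - blinfun_apply (V (X' \<omega>)) (Z' \<omega>))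
        \<le> norm (blinfun_apply (V (X' \<omega>) - V (X \<omega>)) (Z' \<omega>)) + norm (blinfun_apply (V (X \<omega>)) (Z' \<omega> - Z \<omega>))"
      by (simp only: norm_minus_cancel norm_triangle_ineq)
    also have "\<dots> \<le> norm (V (X' \<omega>) - V (X \<omega>)) * norm (Z' \<omega>) + norm (V (X \<omega>)) * norm (Z' \<omega> - Z \<omega>)"
      by (intro add_mono norm_blinfun)
    also have "\<dots> \<le> r * norm (Z' \<omega>) + norm (V (X \<omega>)) * s"
      using close by (intro add_mono mult_right_mono mult_left_mono) auto
    finally show "norm (blinfun_apply (V (X \<omega>)) (Z \<omega>) - blinfun_apply (V (X' \<omega>)) (Z' \<omega>))
        \<le> r * norm (Z' \<omega>) + s * norm (V (X \<omega>))" by (simp add: mult.commute)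
  qed (use int intZ in auto)
  finally show ?thesis using int intZ by simp
qed

text \<open>The factor 4 in the proof makes up for the crude inequality
  \<open>(a + b) powr p \<le> 2 powr p * (a powr p + b powr p)\<close>, used twice in place of Minkowski's.\<close>
lemma (in prob_space) lift_differentiable:
  fixes X :: "'a \<Rightarrow> 'b::{banach, second_countable_topology}"
  assumes p: "1 \<le> p" and f: "W_continuous p f" and X: "X \<in> Lspace (ereal p) M"
    and no_atoms: "\<And>x. measure (distr M borel X) {x} = 0"
    and L: "has_L_derivative p f (distr M borel X) D"
    and V: "AE x in distr M borel X. V x = D x" "continuous_on UNIV V" "growth_bound p C V" "0 \<le> C"
    and e: "0 < e"
  obtains d where "0 < d" "\<And>Y. Y \<in> Lspace (ereal p) M \<Longrightarrow> Lnorm p M (\<lambda>\<omega>. Y \<omega> - X \<omega>) < d \<Longrightarrow>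
    \<bar>f (distr M borel Y) - f (distr M borel X) - (\<integral>\<omega>. blinfun_apply (V (X \<omega>)) (Y \<omega> - X \<omega>) \<partial>M)\<bar>
      \<le> e * Lnorm p M (\<lambda>\<omega>. Y \<omega> - X \<omega>)"
proof -
  let ?\<mu> = "distr M borel X"
  have Xm[measurable]: "X \<in> borel_measurable M"
    using X by (simp add: Lspace_ereal_iff)
  have [measurable]: "V \<in> borel_measurable borel"
    using V(2) by (rule borel_measurable_continuous_onI)
  interpret \<mu>: prob_space ?\<mu> by (rule prob_space_distr) measurable
  have e4: "0 < e / 4" using e by simp
  obtain d where d: "0 < d" "\<And>\<phi>. \<phi> \<in> tangent p ?\<mu> \<Longrightarrow> Lnorm p ?\<mu> \<phi> < d \<Longrightarrow>
     \<bar>f (distr ?\<mu> borel (\<lambda>x. x + \<phi> x)) - f ?\<mu> - (\<integral>x. blinfun_apply (V x) (\<phi> x) \<partial>?\<mu>)\<bar> \<le> e / 4 * Lnorm p ?\<mu> \<phi>"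
    using L_derivative_estimate[OF L sets_distr V(2,1) p e4] by blast
  have "\<bar>f (distr M borel Y) - f ?\<mu> - (\<integral>\<omega>. blinfun_apply (V (X \<omega>)) (Y \<omega> - X \<omega>) \<partial>M)\<bar>
      \<le> e * Lnorm p M (\<lambda>\<omega>. Y \<omega> - X \<omega>)"
    if Y: "Y \<in> Lspace (ereal p) M" and small: "Lnorm p M (\<lambda>\<omega>. Y \<omega> - X \<omega>) < d / 4" for Y
  proof -
    define N where "N = Lnorm p M (\<lambda>\<omega>. Y \<omega> - X \<omega>)"
    have N: "0 \<le> N" unfolding N_def by (rule Lnorm_nonneg)
    define I2 where "I2 = (\<integral>\<omega>. blinfun_apply (V (X \<omega>)) (Y \<omega> - X \<omega>) \<partial>M)"
    have [measurable]: "Y \<in> borel_measurable M"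
      using Y by (simp add: Lspace_ereal_iff)
    \<comment> \<open>\<open>K\<close> collects the coefficients of \<open>\<delta>\<close> in
      \<open>est2\<close> and \<open>est3\<close>: twice the mean distance of the rounded variables,
      itself at most the mean of \<open>norm (Y \<omega> - X \<omega>)\<close> plus 2, and 1 + 2
      times the mean of \<open>norm (V (X \<omega>))\<close>.\<close>
    define K where "K = 2 * (\<integral>\<omega>. norm (Y \<omega> - X \<omega>) \<partial>M) + 4 + 3 * (\<integral>\<omega>. norm (V (X \<omega>)) \<partial>M)"
    \<comment> \<open>\<open>B \<delta>\<close> bounds the norm of \<open>T - Id\<close>: the inner
      sum passes from \<open>Y - X\<close> to the rounded difference, off by at most
      \<open>2 * \<delta>\<close>, and the outer sum passes from \<open>\<alpha>\<close> to the
      identity, off by at most \<open>\<delta>\<close>.\<close>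
    define B where "B \<delta> = (2 powr p * (2 powr p * (N powr p + (2 * \<delta>) powr p) + \<delta> powr p)) powr (1 / p)" for \<delta>
    have YX: "(\<lambda>\<omega>. Y \<omega> - X \<omega>) \<in> Lspace (ereal p) M"
      using Lspace_diff[OF p Y X] .
    \<comment> \<open>The witness \<open>\<nu>\<close> is the law of \<open>T\<close>, which is also
      that of the rounded \<open>Y\<close>: the first form brings in the derivative of
      \<open>f\<close>, the second gives closeness to the law of \<open>Y\<close>.\<close>
    have approx: "\<exists>\<nu>\<in>Prob_p p. Wasserstein p (distr M borel Y) \<nu> \<le> \<delta> \<and> \<bar>f \<nu> - f ?\<mu> - I2\<bar> \<le> e / 4 * B \<delta> + \<delta> * K"
      if \<delta>: "0 < \<delta>" "\<delta> \<le> 1" "B \<delta> < d" for \<delta>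
    proof -
      obtain T \<alpha> \<beta> :: "'b \<Rightarrow> 'b" where meas[measurable]:
        "T \<in> borel_measurable borel" "\<alpha> \<in> borel_measurable borel" "\<beta> \<in> borel_measurable borel"
        and \<alpha>: "\<And>x. dist (\<alpha> x) x < \<delta>" and V\<alpha>: "\<And>x. dist (V (\<alpha> x)) (V x) < \<delta>" and \<beta>: "\<And>x. dist (\<beta> x) x < \<delta>"
        and law: "distr ?\<mu> (borel \<Otimes>\<^sub>M borel) (\<lambda>x. (\<alpha> x, T x)) =
          distr M (borel \<Otimes>\<^sub>M borel) (\<lambda>\<omega>. (\<alpha> (X \<omega>), \<beta> (Y \<omega>)))"
        using exists_discrete_transport[OF Xm \<open>Y \<in> borel_measurable M\<close> no_atoms V(2) \<delta>(1)] by blast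
      have transfer: "(\<integral>x. g (\<alpha> x) (T x) \<partial>?\<mu>) = (\<integral>\<omega>. g (\<alpha> (X \<omega>)) (\<beta> (Y \<omega>)) \<partial>M)"
        if g: "case_prod g \<in> borel_measurable (borel \<Otimes>\<^sub>M borel)" for g :: "'b \<Rightarrow> 'b \<Rightarrow> real"
      proof -
        have "(\<integral>x. g (\<alpha> x) (T x) \<partial>?\<mu>) = (\<integral>z. case_prod g z \<partial>distr ?\<mu> (borel \<Otimes>\<^sub>M borel) (\<lambda>x. (\<alpha> x, T x)))"
          by (subst integral_distr) (use g in auto)
        also have "\<dots> = (\<integral>\<omega>. g (\<alpha> (X \<omega>)) (\<beta> (Y \<omega>)) \<partial>M)"
          unfolding law by (subst integral_distr) (use g in auto)
        finally show ?thesis .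
      qed
      have "distr (distr ?\<mu> (borel \<Otimes>\<^sub>M borel) (\<lambda>x. (\<alpha> x, T x))) borel snd =
          distr (distr M (borel \<Otimes>\<^sub>M borel) (\<lambda>\<omega>. (\<alpha> (X \<omega>), \<beta> (Y \<omega>)))) borel snd"
        unfolding law ..
      then have law_T: "distr ?\<mu> borel T = distr M borel (\<lambda>\<omega>. \<beta> (Y \<omega>))"
        by (subst (asm) (1 2) distr_distr) (auto simp: comp_def)
      have bdd: "(\<lambda>\<omega>. \<beta> (Y \<omega>) - Y \<omega>) \<in> Lspace (ereal p) M" "(\<lambda>\<omega>. \<alpha> (X \<omega>) - X \<omega>) \<in> Lspace (ereal p) M"
        "(\<lambda>x. \<alpha> x - x) \<in> Lspace (ereal p) ?\<mu>"
        using \<alpha> \<beta> p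
        by (auto intro!: Lspace_bounded[where K=\<delta>] \<mu>.Lspace_bounded[where K=\<delta>] less_imp_le simp: dist_norm)
      have \<beta>Y: "(\<lambda>\<omega>. \<beta> (Y \<omega>)) \<in> Lspace (ereal p) M"
        using Lspace_add[OF p bdd(1) Y] by simp
      have \<alpha>X: "(\<lambda>\<omega>. \<alpha> (X \<omega>)) \<in> Lspace (ereal p) M"
        using Lspace_add[OF p bdd(2) X] by simp
      have diff: "(\<lambda>\<omega>. \<beta> (Y \<omega>) - \<alpha> (X \<omega>)) \<in> Lspace (ereal p) M"
        using Lspace_diff[OF p \<beta>Y \<alpha>X] .
      have id: "(\<lambda>x. x) \<in> Lspace (ereal p) ?\<mu>"
        using X by (auto simp: Lspace_ereal_iff integrable_distr_eq)
      have \<alpha>_in: "\<alpha> \<in> Lspace (ereal p) ?\<mu>"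
        using Lspace_add[OF p bdd(3) id] by simp
      have "distr M borel (\<lambda>\<omega>. \<beta> (Y \<omega>)) \<in> Prob_p p"
        by (subst distr_in_Prob_p_iff) (use \<beta>Y in auto)
      then have T_in: "T \<in> Lspace (ereal p) ?\<mu>"
        unfolding law_T[symmetric] by (subst (asm) \<mu>.distr_in_Prob_p_iff) auto
      have T\<alpha>: "(\<lambda>x. T x - \<alpha> x) \<in> Lspace (ereal p) ?\<mu>"
        using Lspace_diff[OF p T_in \<alpha>_in] .
      have \<phi>: "(\<lambda>x. T x - x) \<in> Lspace (ereal p) ?\<mu>"
        using Lspace_diff[OF p T_in id] .
      have "(\<integral>\<omega>. norm (\<beta> (Y \<omega>) - \<alpha> (X \<omega>)) powr p \<partial>M) \<le> (\<integral>\<omega>. 2 powr p * (norm (Y \<omega> - X \<omega>) powr p + (2 * \<delta>) powr p) \<partial>M)"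
      proof (rule integral_mono)
        fix \<omega>
        have "norm (\<beta> (Y \<omega>) - \<alpha> (X \<omega>)) = norm ((Y \<omega> - X \<omega>) + ((\<beta> (Y \<omega>) - Y \<omega>) + (X \<omega> - \<alpha> (X \<omega>))))"
          by simp
        also have "\<dots> \<le> norm (Y \<omega> - X \<omega>) + (norm (\<beta> (Y \<omega>) - Y \<omega>) + norm (X \<omega> - \<alpha> (X \<omega>)))"
          using norm_triangle_ineq[of "Y \<omega> - X \<omega>" "(\<beta> (Y \<omega>) - Y \<omega>) + (X \<omega> - \<alpha> (X \<omega>))"]
            norm_triangle_ineq[of "\<beta> (Y \<omega>) - Y \<omega>" "X \<omega> - \<alpha> (X \<omega>)"] by linarith
        also have "\<dots> \<le> norm (Y \<omega> - X \<omega>) + 2 * \<delta>"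
          using \<beta>[of "Y \<omega>"] \<alpha>[of "X \<omega>"] by (simp add: dist_norm norm_minus_commute)
        finally have "norm (\<beta> (Y \<omega>) - \<alpha> (X \<omega>)) powr p \<le> (norm (Y \<omega> - X \<omega>) + 2 * \<delta>) powr p"
          using p by (intro powr_mono2) auto
        also have "\<dots> \<le> 2 powr p * (norm (Y \<omega> - X \<omega>) powr p + (2 * \<delta>) powr p)"
          using p \<delta> by (intro powr_add_le) auto
        finally show "norm (\<beta> (Y \<omega>) - \<alpha> (X \<omega>)) powr p \<le> 2 powr p * (norm (Y \<omega> - X \<omega>) powr p + (2 * \<delta>) powr p)" .
      qed (use diff YX in \<open>auto simp: Lspace_ereal_iff\<close>)
      also have "\<dots> = 2 powr p * (N powr p + (2 * \<delta>) powr p)"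
        using YX p by (simp add: Lspace_ereal_iff N_def Lnorm_powr prob_space)
      finally have le1: "(\<integral>x. norm (T x - \<alpha> x) powr p \<partial>?\<mu>) \<le> 2 powr p * (N powr p + (2 * \<delta>) powr p)"
        by (subst transfer[of "\<lambda>x y. norm (y - x) powr p"]) auto
      have "(\<integral>x. norm (T x - x) powr p \<partial>?\<mu>) \<le> (\<integral>x. 2 powr p * (norm (T x - \<alpha> x) powr p + \<delta> powr p) \<partial>?\<mu>)"
      proof (rule integral_mono)
        fix x
        have "norm (T x - x) \<le> norm (T x - \<alpha> x) + norm (\<alpha> x - x)"
          using norm_triangle_ineq[of "T x - \<alpha> x" "\<alpha> x - x"] by simp
        also have "\<dots> \<le> norm (T x - \<alpha> x) + \<delta>"
          using \<alpha>[of x] by (simp add: dist_norm)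
        finally have "norm (T x - x) powr p \<le> (norm (T x - \<alpha> x) + \<delta>) powr p"
          using p by (intro powr_mono2) auto
        also have "\<dots> \<le> 2 powr p * (norm (T x - \<alpha> x) powr p + \<delta> powr p)"
          using p \<delta> by (intro powr_add_le) auto
        finally show "norm (T x - x) powr p \<le> 2 powr p * (norm (T x - \<alpha> x) powr p + \<delta> powr p)" .
      qed (use T\<alpha> \<phi> in \<open>auto simp: Lspace_ereal_iff\<close>)
      also have "\<dots> = 2 powr p * ((\<integral>x. norm (T x - \<alpha> x) powr p \<partial>?\<mu>) + \<delta> powr p)"
        using T\<alpha> \<mu>.prob_space by (simp add: Lspace_ereal_iff)
      also have "\<dots> \<le> 2 powr p * (2 powr p * (N powr p + (2 * \<delta>) powr p) + \<delta> powr p)"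
        using le1 by simp
      finally have norm_le: "Lnorm p ?\<mu> (\<lambda>x. T x - x) \<le> B \<delta>"
        unfolding Lnorm_def B_def using p by (intro powr_mono2) auto
      have "\<bar>f (distr ?\<mu> borel (\<lambda>x. x + (T x - x))) - f ?\<mu> - (\<integral>x. blinfun_apply (V x) (T x - x) \<partial>?\<mu>)\<bar>
          \<le> e / 4 * Lnorm p ?\<mu> (\<lambda>x. T x - x)"
        using norm_le \<delta>(3) by (intro d(2) \<phi>) linarith
      also have "\<dots> \<le> e / 4 * B \<delta>"
        using norm_le e by (intro mult_left_mono) auto
      finally have est1: "\<bar>f (distr ?\<mu> borel T) - f ?\<mu> - (\<integral>x. blinfun_apply (V x) (T x - x) \<partial>?\<mu>)\<bar> \<le> e / 4 * B \<delta>"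
        by simp
      have V\<alpha>': "norm (V (\<alpha> x) - V x) \<le> \<delta>" for x
        using V\<alpha>[of x] by (simp add: dist_norm)
      \<comment> \<open>The laws agree for \<open>(\<alpha>, T)\<close>, not for the identity paired
        with \<open>T\<close>. So \<open>est2\<close> inserts \<open>\<alpha>\<close> on the state
        space, \<open>J\<close> carries the pairing to \<open>M\<close>, and \<open>est3\<close>
        removes the rounding there.\<close>
      have est2: "\<bar>(\<integral>x. blinfun_apply (V x) (T x - x) \<partial>?\<mu>) - (\<integral>x. blinfun_apply (V (\<alpha> x)) (T x - \<alpha> x) \<partial>?\<mu>)\<bar>
          \<le> \<delta> * (\<integral>x. norm (T x - \<alpha> x) \<partial>?\<mu>) + \<delta> * (\<integral>x. norm (V x) \<partial>?\<mu>)"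
        using \<alpha> by (intro \<mu>.pairing_perturbation_le[OF V(2,3) p V(4)] id \<phi> \<alpha>_in T\<alpha> V\<alpha>')
          (simp add: dist_norm norm_minus_commute less_imp_le)
      have est3: "\<bar>I2 - (\<integral>\<omega>. blinfun_apply (V (\<alpha> (X \<omega>))) (\<beta> (Y \<omega>) - \<alpha> (X \<omega>)) \<partial>M)\<bar>
          \<le> \<delta> * (\<integral>\<omega>. norm (\<beta> (Y \<omega>) - \<alpha> (X \<omega>)) \<partial>M) + 2 * \<delta> * (\<integral>\<omega>. norm (V (X \<omega>)) \<partial>M)"
        unfolding I2_def
      proof (intro pairing_perturbation_le[OF V(2,3) p V(4)] X YX \<alpha>X diff V\<alpha>')
        fix \<omega>
        show "norm (\<beta> (Y \<omega>) - \<alpha> (X \<omega>) - (Y \<omega> - X \<omega>)) \<le> 2 * \<delta>"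
          using norm_triangle_ineq[of "\<beta> (Y \<omega>) - Y \<omega>" "X \<omega> - \<alpha> (X \<omega>)"] \<beta>[of "Y \<omega>"] \<alpha>[of "X \<omega>"]
          by (simp add: dist_norm norm_minus_commute algebra_simps)
      qed
      have J: "(\<integral>x. blinfun_apply (V (\<alpha> x)) (T x - \<alpha> x) \<partial>?\<mu>) = (\<integral>\<omega>. blinfun_apply (V (\<alpha> (X \<omega>))) (\<beta> (Y \<omega>) - \<alpha> (X \<omega>)) \<partial>M)"
        by (rule transfer[of "\<lambda>x y. blinfun_apply (V x) (y - x)"])
           (auto simp: split_beta' intro!: blinfun_apply_measurable)
      have n1: "(\<integral>x. norm (T x - \<alpha> x) \<partial>?\<mu>) = (\<integral>\<omega>. norm (\<beta> (Y \<omega>) - \<alpha> (X \<omega>)) \<partial>M)"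
        by (rule transfer[of "\<lambda>x y. norm (y - x)"]) auto
      have n2: "(\<integral>x. norm (V x) \<partial>?\<mu>) = (\<integral>\<omega>. norm (V (X \<omega>)) \<partial>M)"
        by (rule integral_distr) auto
      have "(\<integral>\<omega>. norm (\<beta> (Y \<omega>) - \<alpha> (X \<omega>)) \<partial>M) \<le> (\<integral>\<omega>. norm (Y \<omega> - X \<omega>) + 2 \<partial>M)"
      proof (rule integral_mono)
        fix \<omega>
        show "norm (\<beta> (Y \<omega>) - \<alpha> (X \<omega>)) \<le> norm (Y \<omega> - X \<omega>) + 2"
          using norm_triangle_ineq[of "\<beta> (Y \<omega>) - Y \<omega>" "X \<omega> - \<alpha> (X \<omega>)"] \<beta>[of "Y \<omega>"] \<alpha>[of "X \<omega>"] \<delta>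
            norm_triangle_ineq[of "Y \<omega> - X \<omega>" "(\<beta> (Y \<omega>) - Y \<omega>) + (X \<omega> - \<alpha> (X \<omega>))"]
          by (simp add: dist_norm norm_minus_commute algebra_simps)
      qed (use Lspace_integrable[OF p diff] Lspace_integrable[OF p YX] in auto)
      also have "\<dots> = (\<integral>\<omega>. norm (Y \<omega> - X \<omega>) \<partial>M) + 2"
        using Lspace_integrable[OF p YX] by (simp add: prob_space)
      finally have "\<delta> * (\<integral>\<omega>. norm (\<beta> (Y \<omega>) - \<alpha> (X \<omega>)) \<partial>M) \<le> \<delta> * ((\<integral>\<omega>. norm (Y \<omega> - X \<omega>) \<partial>M) + 2)"
        using \<delta> by (intro mult_left_mono) auto
      then have "2 * (\<delta> * (\<integral>\<omega>. norm (\<beta> (Y \<omega>) - \<alpha> (X \<omega>)) \<partial>M)) + 3 * (\<delta> * (\<integral>\<omega>. norm (V (X \<omega>)) \<partial>M)) \<le> \<delta> * K"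
        by (simp add: K_def algebra_simps)
      then have "\<bar>f (distr ?\<mu> borel T) - f ?\<mu> - I2\<bar> \<le> e / 4 * B \<delta> + \<delta> * K"
        using est1 est2 est3 unfolding J n1 n2 by linarith
      moreover have "distr ?\<mu> borel T \<in> Prob_p p"
        by (subst \<mu>.distr_in_Prob_p_iff) (use T_in in auto)
      moreover have "Wasserstein p (distr M borel Y) (distr ?\<mu> borel T) \<le> \<delta>"
      proof -
        have "Wasserstein p (distr M borel Y) (distr M borel (\<lambda>\<omega>. \<beta> (Y \<omega>))) \<le> Lnorm p M (\<lambda>\<omega>. Y \<omega> - \<beta> (Y \<omega>))"
          by (rule Wasserstein_distr_le) measurable
        also have "\<dots> \<le> \<delta>"
        proof (subst Lnorm_le_iff)
          have "(\<integral>\<omega>. norm (Y \<omega> - \<beta> (Y \<omega>)) powr p \<partial>M) \<le> (\<integral>\<omega>. \<delta> powr p \<partial>M)"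
            by (intro integral_mono powr_mono2)
               (use bdd(1) \<beta> p in \<open>auto simp: Lspace_ereal_iff dist_norm norm_minus_commute less_imp_le\<close>)
          then show "(\<integral>\<omega>. norm (Y \<omega> - \<beta> (Y \<omega>)) powr p \<partial>M) \<le> \<delta> powr p"
            by (simp add: prob_space)
        qed (use p \<delta> in auto)
        finally show ?thesis unfolding law_T .
      qed
      ultimately show ?thesis by blast
    qed
    have B_lim: "(B \<longlongrightarrow> 4 * N) (at_right 0)"
    proof -
      have pw: "((\<lambda>\<delta>. (c * \<delta>) powr p) \<longlongrightarrow> 0) (at_right 0)" if "0 \<le> c" for c :: real
      proof -
        have "((\<lambda>\<delta>. (c * \<delta>) powr p) \<longlongrightarrow> 0 powr p) (at_right 0)"
        proof (rule tendsto_powr')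
          show "((\<lambda>\<delta>. c * \<delta>) \<longlongrightarrow> 0) (at_right 0)"
            by (auto intro!: tendsto_eq_intros)
          have "eventually (\<lambda>\<delta>::real. 0 \<le> c * \<delta>) (at_right 0)"
            using eventually_at_right_less[of "0::real"] by eventually_elim (use that in auto)
          then show "0 \<noteq> 0 \<or> 0 < p \<and> eventually (\<lambda>\<delta>. 0 \<le> c * \<delta>) (at_right 0)"
            using p by simp
        qed simp
        then show ?thesis by simp
      qed
      have "(B \<longlongrightarrow> (2 powr p * (2 powr p * (N powr p + 0) + 0)) powr (1 / p)) (at_right 0)"
        unfolding B_def using pw[of 1] pw[of 2] p
        by (intro tendsto_powr' tendsto_intros) auto
      also have "(2 powr p * (2 powr p * (N powr p + 0) + 0)) powr (1 / p) = 4 * N"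
        using p N by (simp add: powr_mult powr_powr)
      finally show ?thesis .
    qed
    \<comment> \<open>For fixed \<open>Y\<close> let \<open>\<delta>\<close> tend to 0: continuity
      of \<open>f\<close> at the law of \<open>Y\<close> replaces \<open>\<nu>\<close> by that law,
      and \<open>e / 4 * B \<delta>\<close> tends to \<open>e * N\<close>. The smallness of
      \<open>N\<close> is what makes \<open>B \<delta> < d\<close> eventually.\<close>
    have "\<bar>f (distr M borel Y) - f ?\<mu> - I2\<bar> \<le> e * N + r" if r: "0 < r" for r
    proof -
      have YP: "distr M borel Y \<in> Prob_p p"
        by (subst distr_in_Prob_p_iff) (use Y in auto)
      then obtain d' where d': "0 < d'" "\<And>\<nu>. \<nu> \<in> Prob_p p \<Longrightarrow> Wasserstein p (distr M borel Y) \<nu> < d' \<Longrightarrow> \<bar>f \<nu> - f (distr M borel Y)\<bar> < r / 2"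
        using f r unfolding W_continuous_def by (meson half_gt_zero)
      have lim: "((\<lambda>\<delta>. e / 4 * B \<delta> + \<delta> * K) \<longlongrightarrow> e / 4 * (4 * N) + 0 * K) (at_right 0)"
        by (intro tendsto_intros B_lim)
      have "eventually (\<lambda>\<delta>. e / 4 * B \<delta> + \<delta> * K < e * N + r / 2) (at_right 0)"
        using order_tendstoD(2)[OF lim] r by simp
      moreover have "eventually (\<lambda>\<delta>. B \<delta> < d) (at_right 0)"
        using order_tendstoD(2)[OF B_lim] small by (simp add: N_def)
      moreover have "eventually (\<lambda>\<delta>::real. 0 < \<delta> \<and> \<delta> < min 1 d') (at_right 0)"
        using d'(1) by (auto simp: eventually_at_right intro!: exI[of _ "min 1 d'"])
      ultimately have "eventually (\<lambda>\<delta>. e / 4 * B \<delta> + \<delta> * K < e * N + r / 2 \<and> B \<delta> < d \<and> 0 < \<delta> \<and> \<delta> < min 1 d') (at_right 0)"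
        by eventually_elim auto
      then obtain \<delta> where \<delta>: "e / 4 * B \<delta> + \<delta> * K < e * N + r / 2" "B \<delta> < d" "0 < \<delta>" "\<delta> < min 1 d'"
        using eventually_happens'[OF trivial_limit_at_right_real] by blast
      obtain \<nu> where \<nu>: "\<nu> \<in> Prob_p p" "Wasserstein p (distr M borel Y) \<nu> \<le> \<delta>" "\<bar>f \<nu> - f ?\<mu> - I2\<bar> \<le> e / 4 * B \<delta> + \<delta> * K"
        using approx[of \<delta>] \<delta> by auto
      have "\<bar>f \<nu> - f (distr M borel Y)\<bar> < r / 2"
        using d'(2)[OF \<nu>(1)] \<nu>(2) \<delta> by simp
      then show ?thesis using \<nu>(3) \<delta>(1) by linarith
    qed
    then show ?thesis unfolding N_def[symmetric] I2_def by (rule field_le_epsilon)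
  qed
  with d(1) show ?thesis using that[of "d / 4"] by simp
qed

subsection \<open>Convergence of the pairing\<close>

text \<open>Minkowski's inequality up to a constant: one factor 2 comes from
  \<open>norm_add_powr_le\<close>, the other from bounding the sum of two powers by
  \<open>2 powr p\<close> times the power of the sum. The constant is harmless, as the inequality
  only serves to show that norms are small or of order \<open>\<epsilon>\<close>.\<close>

lemma Lnorm_add_le:
  fixes g h :: "'a \<Rightarrow> 'b::{banach, second_countable_topology}"
  assumes p: "1 \<le> p" and g: "g \<in> Lspace (ereal p) M" and h: "h \<in> Lspace (ereal p) M"
  shows "Lnorm p M (\<lambda>x. g x + h x) \<le> 4 * (Lnorm p M g + Lnorm p M h)"
proof -
  let ?a = "Lnorm p M g" and ?b = "Lnorm p M h"
  have nn: "0 \<le> ?a" "0 \<le> ?b" by (auto simp: Lnorm_nonneg)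
  have "(\<integral>x. norm (g x + h x) powr p \<partial>M) \<le> (\<integral>x. 2 powr p * (norm (g x) powr p + norm (h x) powr p) \<partial>M)"
    using Lspace_add[OF p g h] g h p
    by (intro integral_mono norm_add_powr_le) (auto simp: Lspace_ereal_iff)
  also have "\<dots> = 2 powr p * (?a powr p + ?b powr p)"
    using g h p by (simp add: Lspace_ereal_iff Lnorm_powr)
  also have "?a powr p + ?b powr p \<le> (?a + ?b) powr p + (?a + ?b) powr p"
    using nn p by (intro add_mono powr_mono2) auto
  also have "\<dots> \<le> 2 powr p * (?a + ?b) powr p"
  proof -
    have "(2::real) powr 1 \<le> 2 powr p" using p by (intro powr_mono) auto
    then have "2 * (?a + ?b) powr p \<le> 2 powr p * (?a + ?b) powr p"
      by (intro mult_right_mono) auto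
    then show ?thesis by simp
  qed
  also have "2 powr p * (2 powr p * (?a + ?b) powr p) = (4 * (?a + ?b)) powr p"
    using powr_mult[of 2 2 p] powr_mult[of 4 "?a + ?b" p] by simp
  finally show ?thesis
    using p nn by (subst Lnorm_le_iff) auto
qed

lemma Lnorm_minus_commute:
  "Lnorm p M (\<lambda>x. g x - h x) = Lnorm p M (\<lambda>x. h x - g x)"
  by (simp add: Lnorm_def norm_minus_commute)

text \<open>The subsequence criterion for limits, called for because convergence in
  \<open>L\<^sup>p\<close> gives almost sure convergence only along subsequences. \<open>P\<close>
  lets the sequence be taken where the variables are known to be well behaved.\<close>

lemma tendsto_at_right_subseq:
  fixes a :: "real \<Rightarrow> 'c::metric_space"
  assumes ev: "eventually P (at_right 0)"
    and sub: "\<And>s. (\<And>n. 0 < s n) \<Longrightarrow> (\<And>n. P (s n)) \<Longrightarrow> filterlim s (at_right 0) sequentially \<Longrightarrow>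
      \<exists>r::nat \<Rightarrow> nat. strict_mono r \<and> (\<lambda>n. a (s (r n))) \<longlonglongrightarrow> L"
  shows "(a \<longlongrightarrow> L) (at_right 0)"
proof (rule ccontr)
  assume "\<not> (a \<longlongrightarrow> L) (at_right 0)"
  then obtain e where e: "0 < e" "\<not> eventually (\<lambda>x. dist (a x) L < e) (at_right 0)"
    by (auto simp: tendsto_iff)
  have "\<exists>x. 0 < x \<and> x < 1 / real (Suc n) \<and> P x \<and> \<not> dist (a x) L < e" for n
  proof (rule ccontr)
    assume *: "\<nexists>x. 0 < x \<and> x < 1 / real (Suc n) \<and> P x \<and> \<not> dist (a x) L < e"
    have "eventually (\<lambda>x::real. 0 < x \<and> x < 1 / real (Suc n)) (at_right 0)"
      using eventually_at_right_real[of 0 "1 / real (Suc n)"] by simp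
    with ev have "eventually (\<lambda>x. dist (a x) L < e) (at_right 0)"
      by eventually_elim (use * in blast)
    with e(2) show False by blast
  qed
  then obtain s where s: "\<And>n. 0 < s n" "\<And>n. s n < 1 / real (Suc n)" "\<And>n. P (s n)"
    "\<And>n. \<not> dist (a (s n)) L < e"
    by metis
  have "s \<longlonglongrightarrow> 0"
  proof (rule tendsto_sandwich[OF _ _ tendsto_const])
    show "(\<lambda>n. 1 / real (Suc n)) \<longlonglongrightarrow> 0" by (rule LIMSEQ_Suc[OF lim_1_over_n])
  qed (use s in \<open>auto intro!: always_eventually less_imp_le\<close>)
  then have "filterlim s (at_right 0) sequentially"
    using s(1) by (simp add: filterlim_at less_imp_neq[symmetric])
  from sub[OF s(1) s(3) this] obtain r where "strict_mono r" "(\<lambda>n. a (s (r n))) \<longlonglongrightarrow> L" by blast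
  then have "eventually (\<lambda>n. dist (a (s (r n))) L < e) sequentially"
    using e(1) by (auto simp: tendsto_iff)
  then show False using s(4) by (auto simp: eventually_sequentially)
qed

text \<open>The diagonal coupling has cost 0. An upper bound is enough to place \<open>\<mu>\<close>
  in the balls around it.\<close>

lemma Wasserstein_refl:
  fixes \<mu> :: "'b::{banach, second_countable_topology} measure"
  assumes "\<mu> \<in> Prob_p p" "0 < p"
  shows "Wasserstein p \<mu> \<mu> \<le> 0"
proof -
  have s: "sets \<mu> = sets borel" and pr: "prob_space \<mu>" using assms by (auto simp: Prob_p_def)
  have m: "(\<lambda>x. x) \<in> borel_measurable \<mu>"
    using s by (simp add: measurable_cong_sets[OF s refl])
  have "distr \<mu> borel (\<lambda>x. x) = \<mu>"
    by (rule distr_id2) (simp add: s)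
  with prob_space.Wasserstein_distr_le[OF pr m m, of p] show ?thesis
    using assms(2) by (simp add: Lnorm_def)
qed

lemma W_jointly_continuous_on_imp_continuous_on:
  assumes "W_jointly_continuous_on p U V" "\<mu> \<in> U" "U \<subseteq> Prob_p p" "0 < p"
  shows "continuous_on UNIV (V \<mu>)"
  unfolding continuous_on_iff
proof (intro ballI allI impI)
  fix x and e :: real assume "0 < e"
  then obtain d where d: "0 < d" "\<And>y \<nu>. \<nu> \<in> U \<Longrightarrow> norm (y - x) < d \<Longrightarrow> Wasserstein p \<mu> \<nu> < d \<Longrightarrow> norm (V \<nu> y - V \<mu> x) < e"
    using assms(1,2) unfolding W_jointly_continuous_on_def by meson
  have "Wasserstein p \<mu> \<mu> < d" using Wasserstein_refl[of \<mu> p] assms d(1) by fastforce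
  then show "\<exists>d>0. \<forall>x'\<in>UNIV. dist x' x < d \<longrightarrow> dist (V \<mu> x') (V \<mu> x) < e"
    using d assms(2) by (auto simp: dist_norm intro!: exI[of _ d])
qed

text \<open>The function \<open>V\<close> at the law of \<open>Xs n\<close> and its argument move
  together. The Wasserstein distance is controlled by the norm of \<open>Xs n - X\<close>, so joint
  continuity gives pointwise convergence once \<open>Xs\<close> and \<open>\<eta>s\<close> converge
  almost surely along a common subsequence.\<close>

lemma (in prob_space) pairing_tendsto_subseq:
  fixes X \<eta> :: "'a \<Rightarrow> 'b::{banach, second_countable_topology}" and Xs \<eta>s :: "nat \<Rightarrow> 'a \<Rightarrow> 'b"
  assumes p: "1 \<le> p" and V: "W_jointly_continuous_on p U V" "\<And>\<mu>. \<mu> \<in> U \<Longrightarrow> growth_bound p C (V \<mu>)" "0 \<le> C" "U \<subseteq> Prob_p p"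
    and X: "X \<in> Lspace (ereal p) M" and \<eta>: "\<eta> \<in> Lspace (ereal p) M" and XU: "distr M borel X \<in> U"
    and Xs: "\<And>n. Xs n \<in> Lspace (ereal p) M" and \<eta>s: "\<And>n. \<eta>s n \<in> Lspace (ereal p) M"
    and XsU: "\<And>n. distr M borel (Xs n) \<in> U"
    and Xs_lim: "(\<lambda>n. Lnorm p M (\<lambda>\<omega>. Xs n \<omega> - X \<omega>)) \<longlonglongrightarrow> 0"
    and \<eta>s_lim: "(\<lambda>n. Lnorm p M (\<lambda>\<omega>. \<eta>s n \<omega> - \<eta> \<omega>)) \<longlonglongrightarrow> 0"
  shows "\<exists>r::nat \<Rightarrow> nat. strict_mono r \<and>
    (\<lambda>n. \<integral>\<omega>. blinfun_apply (V (distr M borel (Xs (r n))) (Xs (r n) \<omega>)) (\<eta>s (r n) \<omega>) \<partial>M)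
      \<longlonglongrightarrow> (\<integral>\<omega>. blinfun_apply (V (distr M borel X) (X \<omega>)) (\<eta> \<omega>) \<partial>M)"
proof -
  have p0: "0 < p" using p by simp
  have meas: "X \<in> borel_measurable M" "\<And>n. Xs n \<in> borel_measurable M"
    using X Xs by (auto simp: Lspace_ereal_iff)
  \<comment> \<open>Adding the two errors yields one subsequence that works for both.\<close>
  define A where "A n \<omega> = norm (Xs n \<omega> - X \<omega>) powr p + norm (\<eta>s n \<omega> - \<eta> \<omega>) powr p" for n \<omega>
  have dX: "(\<lambda>\<omega>. Xs n \<omega> - X \<omega>) \<in> Lspace (ereal p) M" for n
    by (rule Lspace_diff[OF p Xs X])
  have d\<eta>: "(\<lambda>\<omega>. \<eta>s n \<omega> - \<eta> \<omega>) \<in> Lspace (ereal p) M" for n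
    by (rule Lspace_diff[OF p \<eta>s \<eta>])
  have A_int: "integrable M (A n)" for n
    using dX[of n] d\<eta>[of n] by (simp add: A_def[abs_def] Lspace_ereal_iff)
  have A_nonneg: "0 \<le> A n \<omega>" for n \<omega>
    by (simp add: A_def)
  have powr_lim: "(\<lambda>n. u n powr p) \<longlonglongrightarrow> 0" if "u \<longlonglongrightarrow> 0" "\<And>n. 0 \<le> u n" for u :: "nat \<Rightarrow> real"
    using tendsto_powr'[OF that(1) tendsto_const[of p]] that(2) p0 by simp
  have A_eq: "(\<integral>\<omega>. A n \<omega> \<partial>M) = Lnorm p M (\<lambda>\<omega>. Xs n \<omega> - X \<omega>) powr p + Lnorm p M (\<lambda>\<omega>. \<eta>s n \<omega> - \<eta> \<omega>) powr p" for n
    using dX[of n] d\<eta>[of n] p0 by (simp add: A_def Lspace_ereal_iff Lnorm_powr)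
  have A_lim: "(\<lambda>n. \<integral>\<omega>. A n \<omega> \<partial>M) \<longlonglongrightarrow> 0"
    unfolding A_eq using tendsto_add[OF powr_lim[OF Xs_lim Lnorm_nonneg] powr_lim[OF \<eta>s_lim Lnorm_nonneg]] by simp
  then have "(\<lambda>n. \<integral>\<omega>. norm (A n \<omega>) \<partial>M) \<longlonglongrightarrow> 0"
    using A_nonneg by simp
  from tendsto_L1_AE_subseq[OF A_int this] obtain r where r: "strict_mono r"
    and r_lim: "AE \<omega> in M. (\<lambda>n. A (r n) \<omega>) \<longlonglongrightarrow> 0" by blast
  define W where "W n \<omega> = V (distr M borel (Xs n)) (Xs n \<omega>)" for n \<omega>
  define W0 where "W0 \<omega> = V (distr M borel X) (X \<omega>)" for \<omega>
  have W_int: "integrable M (\<lambda>\<omega>. blinfun_apply (W n \<omega>) (\<eta>s n \<omega>))" for n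
    unfolding W_def
    by (rule growth_bound_integrable(1)[OF W_jointly_continuous_on_imp_continuous_on[OF V(1) XsU V(4) p0] V(2)[OF XsU] p V(3) Xs \<eta>s])
  have W0_int: "integrable M (\<lambda>\<omega>. blinfun_apply (W0 \<omega>) (\<eta> \<omega>))"
    unfolding W0_def
    by (rule growth_bound_integrable(1)[OF W_jointly_continuous_on_imp_continuous_on[OF V(1) XU V(4) p0] V(2)[OF XU] p V(3) X \<eta>])
  have root_lim: "v \<longlonglongrightarrow> v0" if "(\<lambda>n. norm (v n - v0) powr p) \<longlonglongrightarrow> 0" for v :: "nat \<Rightarrow> 'b" and v0
  proof -
    have "(\<lambda>n. (norm (v n - v0) powr p) powr (1 / p)) \<longlonglongrightarrow> 0 powr (1 / p)"
      by (rule tendsto_powr'[OF that tendsto_const]) (use p0 in simp)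
    then have "(\<lambda>n. norm (v n - v0)) \<longlonglongrightarrow> 0"
      using p0 by (simp add: powr_powr)
    then show ?thesis
      using LIM_zero_cancel tendsto_norm_zero_iff by blast
  qed
  have "(\<lambda>n. Wasserstein p (distr M borel X) (distr M borel (Xs (r n)))) \<longlonglongrightarrow> 0"
  proof (rule tendsto_sandwich[OF _ _ tendsto_const])
    show "(\<lambda>n. Lnorm p M (\<lambda>\<omega>. Xs (r n) \<omega> - X \<omega>)) \<longlonglongrightarrow> 0"
      using LIMSEQ_subseq_LIMSEQ[OF Xs_lim r] by (simp add: comp_def)
    show "\<forall>\<^sub>F n in sequentially. Wasserstein p (distr M borel X) (distr M borel (Xs (r n))) \<le> Lnorm p M (\<lambda>\<omega>. Xs (r n) \<omega> - X \<omega>)"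
      using Wasserstein_distr_le[OF meas] by (subst Lnorm_minus_commute) simp
    \<comment> \<open>On the reals the infimum of the empty set carries no information, so
      nonnegativity needs a coupling.\<close>
    have "couplings (distr M borel X) (distr M borel (Xs (r n))) \<noteq> {}" for n
    proof -
      have "distr M (borel \<Otimes>\<^sub>M borel) (\<lambda>\<omega>. (X \<omega>, Xs (r n) \<omega>)) \<in> couplings (distr M borel X) (distr M borel (Xs (r n)))"
        using meas by (auto simp: couplings_def prob_space_distr distr_distr comp_def)
      then show ?thesis by blast
    qed
    then show "\<forall>\<^sub>F n in sequentially. 0 \<le> Wasserstein p (distr M borel X) (distr M borel (Xs (r n)))"
      unfolding Wasserstein_def by (intro always_eventually allI cINF_greatest) auto
  qed
  note Wass_lim = this
  define g where "g n \<omega> = norm (blinfun_apply (W (r n) \<omega>) (\<eta>s (r n) \<omega>) - blinfun_apply (W0 \<omega>) (\<eta> \<omega>))" for n \<omega>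
  have g_int: "integrable M (g n)" for n
    unfolding g_def using W_int W0_int by (intro integrable_norm Bochner_Integration.integrable_diff)
  have "(\<lambda>n. \<integral>\<omega>. g n \<omega> \<partial>M) \<longlonglongrightarrow> 0"
  proof (rule tendsto_integral_dominated_plus_null[OF g_int])
    \<comment> \<open>The growth bound at \<open>Xs\<close> and \<open>\<eta>s\<close> is split into
      a part in \<open>X\<close> and \<open>\<eta>\<close>, which goes to \<open>?H\<close>, and a
      part in the differences, which goes to \<open>?R\<close> and vanishes in the mean.\<close>
    let ?H = "\<lambda>\<omega>. C * (2 + (1 + 2 powr p) * norm (X \<omega>) powr p + (2 + 2 * 2 powr p) * norm (\<eta> \<omega>) powr p)"
    let ?R = "\<lambda>n \<omega>. C * (2 * 2 powr p) * A (r n) \<omega>"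
    show "integrable M (?R n)" for n
      using A_int by simp
    show "integrable M ?H"
      using X \<eta> by (simp add: Lspace_ereal_iff)
    show "0 \<le> g n \<omega>" "0 \<le> ?R n \<omega>" for n \<omega>
      using A_nonneg V(3) by (auto simp: g_def)
    show "g n \<omega> \<le> ?H \<omega> + ?R n \<omega>" for n \<omega>
    proof -
      let ?x = "Xs (r n) \<omega>" and ?y = "\<eta>s (r n) \<omega>"
      have "g n \<omega> \<le> norm (blinfun_apply (W (r n) \<omega>) ?y) + norm (blinfun_apply (W0 \<omega>) (\<eta> \<omega>))"
        unfolding g_def by (rule norm_triangle_ineq4)
      also have "\<dots> \<le> norm (W (r n) \<omega>) * norm ?y + norm (W0 \<omega>) * norm (\<eta> \<omega>)"
        by (intro add_mono norm_blinfun)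
      also have "\<dots> \<le> C * (1 + norm ?x powr p + 2 * norm ?y powr p) + C * (1 + norm (X \<omega>) powr p + 2 * norm (\<eta> \<omega>) powr p)"
        unfolding W_def W0_def by (intro add_mono growth_bound_pairing_le V XU XsU p)
      also have "\<dots> = C * (2 + norm (X \<omega>) powr p + 2 * norm (\<eta> \<omega>) powr p + (norm ?x powr p + 2 * norm ?y powr p))"
        by (simp add: algebra_simps)
      also have "\<dots> \<le> C * (2 + norm (X \<omega>) powr p + 2 * norm (\<eta> \<omega>) powr p
          + (2 powr p * (norm (?x - X \<omega>) powr p + norm (X \<omega>) powr p) + 2 * (2 powr p * (norm (?y - \<eta> \<omega>) powr p + norm (\<eta> \<omega>) powr p))))"
      proof -
        have "norm ?x powr p \<le> 2 powr p * (norm (?x - X \<omega>) powr p + norm (X \<omega>) powr p)"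
          "norm ?y powr p \<le> 2 powr p * (norm (?y - \<eta> \<omega>) powr p + norm (\<eta> \<omega>) powr p)"
          using norm_add_powr_le[of p "?x - X \<omega>" "X \<omega>"] norm_add_powr_le[of p "?y - \<eta> \<omega>" "\<eta> \<omega>"] p0 by auto
        then show ?thesis using V(3) by (intro mult_left_mono add_left_mono add_mono) auto
      qed
      also have "\<dots> = ?H \<omega> + C * (2 powr p * norm (?x - X \<omega>) powr p + 2 * 2 powr p * norm (?y - \<eta> \<omega>) powr p)"
        by (simp add: algebra_simps)
      also have "\<dots> \<le> ?H \<omega> + C * (2 * 2 powr p * norm (?x - X \<omega>) powr p + 2 * 2 powr p * norm (?y - \<eta> \<omega>) powr p)"
        using V(3) by (intro add_left_mono mult_left_mono add_right_mono mult_right_mono) auto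
      also have "\<dots> = ?H \<omega> + ?R n \<omega>"
        by (simp add: A_def algebra_simps)
      finally show ?thesis .
    qed
    show "AE \<omega> in M. (\<lambda>n. g n \<omega>) \<longlonglongrightarrow> 0"
      using r_lim
    proof eventually_elim
      case (elim \<omega>)
      have x_lim: "(\<lambda>n. Xs (r n) \<omega>) \<longlonglongrightarrow> X \<omega>"
        by (rule root_lim, rule tendsto_sandwich[OF _ _ tendsto_const elim]) (auto simp: A_def)
      have y_lim: "(\<lambda>n. \<eta>s (r n) \<omega>) \<longlonglongrightarrow> \<eta> \<omega>"
        by (rule root_lim, rule tendsto_sandwich[OF _ _ tendsto_const elim]) (auto simp: A_def)
      have W_lim: "(\<lambda>n. W (r n) \<omega>) \<longlonglongrightarrow> W0 \<omega>"
      proof (rule metric_LIMSEQ_I)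
        fix e :: real assume "0 < e"
        then obtain d where d: "0 < d" "\<And>y \<nu>. \<nu> \<in> U \<Longrightarrow> norm (y - X \<omega>) < d \<Longrightarrow> Wasserstein p (distr M borel X) \<nu> < d \<Longrightarrow>
            norm (V \<nu> y - V (distr M borel X) (X \<omega>)) < e"
          using V(1) XU unfolding W_jointly_continuous_on_def by meson
        have "eventually (\<lambda>n. dist (Xs (r n) \<omega>) (X \<omega>) < d) sequentially"
          using x_lim d(1) by (auto simp: tendsto_iff)
        moreover have "eventually (\<lambda>n. Wasserstein p (distr M borel X) (distr M borel (Xs (r n))) < d) sequentially"
          using order_tendstoD(2)[OF Wass_lim d(1)] .
        ultimately have "eventually (\<lambda>n. dist (W (r n) \<omega>) (W0 \<omega>) < e) sequentially"
          by eventually_elim (use d(2) XsU in \<open>auto simp: W_def W0_def dist_norm\<close>)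
        then show "\<exists>N. \<forall>n\<ge>N. dist (W (r n) \<omega>) (W0 \<omega>) < e"
          by (simp add: eventually_sequentially)
      qed
      have "(\<lambda>n. g n \<omega>) \<longlonglongrightarrow> norm (blinfun_apply (W0 \<omega>) (\<eta> \<omega>) - blinfun_apply (W0 \<omega>) (\<eta> \<omega>))"
        unfolding g_def by (intro tendsto_intros W_lim y_lim)
      then show ?case by simp
    qed
    show "(\<lambda>n. \<integral>\<omega>. ?R n \<omega> \<partial>M) \<longlonglongrightarrow> 0"
      using tendsto_mult_right_zero[OF LIMSEQ_subseq_LIMSEQ[OF A_lim r]] by (simp add: comp_def)
  qed
  then have "(\<lambda>n. (\<integral>\<omega>. blinfun_apply (W (r n) \<omega>) (\<eta>s (r n) \<omega>) \<partial>M) - (\<integral>\<omega>. blinfun_apply (W0 \<omega>) (\<eta> \<omega>) \<partial>M)) \<longlonglongrightarrow> 0"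
  proof (rule Lim_null_comparison[rotated], intro always_eventually allI)
    fix n
    have "(\<integral>\<omega>. blinfun_apply (W (r n) \<omega>) (\<eta>s (r n) \<omega>) \<partial>M) - (\<integral>\<omega>. blinfun_apply (W0 \<omega>) (\<eta> \<omega>) \<partial>M)
      = (\<integral>\<omega>. blinfun_apply (W (r n) \<omega>) (\<eta>s (r n) \<omega>) - blinfun_apply (W0 \<omega>) (\<eta> \<omega>) \<partial>M)"
      using W_int W0_int by simp
    then show "norm ((\<integral>\<omega>. blinfun_apply (W (r n) \<omega>) (\<eta>s (r n) \<omega>) \<partial>M) - (\<integral>\<omega>. blinfun_apply (W0 \<omega>) (\<eta> \<omega>) \<partial>M)) \<le> (\<integral>\<omega>. g n \<omega> \<partial>M)"
      unfolding g_def by (simp only: integral_norm_bound)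
  qed
  then have "(\<lambda>n. \<integral>\<omega>. blinfun_apply (W (r n) \<omega>) (\<eta>s (r n) \<omega>) \<partial>M) \<longlonglongrightarrow> (\<integral>\<omega>. blinfun_apply (W0 \<omega>) (\<eta> \<omega>) \<partial>M)"
    by (rule LIM_zero_cancel)
  with r show ?thesis
    unfolding W_def W0_def by (intro exI[of _ r] conjI)
qed

lemma (in prob_space) pairing_tendsto_at_right:
  fixes X \<eta> :: "'a \<Rightarrow> 'b::{banach, second_countable_topology}" and Xs \<eta>s :: "real \<Rightarrow> 'a \<Rightarrow> 'b"
  assumes p: "1 \<le> p" and V: "W_jointly_continuous_on p U V" "\<And>\<mu>. \<mu> \<in> U \<Longrightarrow> growth_bound p C (V \<mu>)" "0 \<le> C" "U \<subseteq> Prob_p p"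
    and X: "X \<in> Lspace (ereal p) M" and \<eta>: "\<eta> \<in> Lspace (ereal p) M" and XU: "distr M borel X \<in> U"
    and ev: "\<forall>\<^sub>F \<epsilon> in at_right 0. Xs \<epsilon> \<in> Lspace (ereal p) M \<and> \<eta>s \<epsilon> \<in> Lspace (ereal p) M \<and> distr M borel (Xs \<epsilon>) \<in> U"
    and Xs_lim: "((\<lambda>\<epsilon>. Lnorm p M (\<lambda>\<omega>. Xs \<epsilon> \<omega> - X \<omega>)) \<longlongrightarrow> 0) (at_right 0)"
    and \<eta>s_lim: "((\<lambda>\<epsilon>. Lnorm p M (\<lambda>\<omega>. \<eta>s \<epsilon> \<omega> - \<eta> \<omega>)) \<longlongrightarrow> 0) (at_right 0)"
  shows "((\<lambda>\<epsilon>. \<integral>\<omega>. blinfun_apply (V (distr M borel (Xs \<epsilon>)) (Xs \<epsilon> \<omega>)) (\<eta>s \<epsilon> \<omega>) \<partial>M)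
      \<longlongrightarrow> (\<integral>\<omega>. blinfun_apply (V (distr M borel X) (X \<omega>)) (\<eta> \<omega>) \<partial>M)) (at_right 0)"
proof (rule tendsto_at_right_subseq[OF ev])
  fix s :: "nat \<Rightarrow> real"
  assume P: "\<And>n. Xs (s n) \<in> Lspace (ereal p) M \<and> \<eta>s (s n) \<in> Lspace (ereal p) M \<and> distr M borel (Xs (s n)) \<in> U"
    and s: "filterlim s (at_right 0) sequentially"
  show "\<exists>r. strict_mono r \<and>
      (\<lambda>n. \<integral>\<omega>. blinfun_apply (V (distr M borel (Xs (s (r n)))) (Xs (s (r n)) \<omega>)) (\<eta>s (s (r n)) \<omega>) \<partial>M)
        \<longlonglongrightarrow> (\<integral>\<omega>. blinfun_apply (V (distr M borel X) (X \<omega>)) (\<eta> \<omega>) \<partial>M)"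
    using P filterlim_compose[OF Xs_lim s] filterlim_compose[OF \<eta>s_lim s]
    by (intro pairing_tendsto_subseq[OF p V X \<eta> XU, of "\<lambda>n. Xs (s n)" "\<lambda>n. \<eta>s (s n)"]) auto
qed

subsection \<open>The chain rule\<close>

lemma (in prob_space) Lp_right_derivative_bound:
  fixes \<xi> :: "real \<Rightarrow> 'a \<Rightarrow> 'b::{banach, second_countable_topology}"
  assumes p: "1 \<le> p" and \<xi>: "\<And>\<epsilon>. \<epsilon> \<in> {0..1} \<Longrightarrow> \<xi> \<epsilon> \<in> Lspace (ereal p) M"
    and deriv: "Lp_right_derivative p M \<xi> \<eta>"
  obtains K where "0 \<le> K" "\<forall>\<^sub>F \<epsilon> in at_right 0. Lnorm p M (\<lambda>\<omega>. \<xi> \<epsilon> \<omega> - \<xi> 0 \<omega>) \<le> K * \<epsilon>"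
    "((\<lambda>\<epsilon>. Lnorm p M (\<lambda>\<omega>. \<xi> \<epsilon> \<omega> - \<xi> 0 \<omega>)) \<longlongrightarrow> 0) (at_right 0)"
proof -
  have \<eta>: "\<eta> \<in> Lspace (ereal p) M"
    and lim: "((\<lambda>\<epsilon>. Lnorm p M (\<lambda>\<omega>. (\<xi> \<epsilon> \<omega> - \<xi> 0 \<omega>) /\<^sub>R \<epsilon> - \<eta> \<omega>)) \<longlongrightarrow> 0) (at_right 0)"
    using deriv by (auto simp: Lp_right_derivative_def)
  \<comment> \<open>Once the difference quotient is within 1 of \<open>\<eta>\<close>,
    \<open>Lnorm_add_le\<close> bounds its norm by this number.\<close>
  define K where "K = 4 * (1 + Lnorm p M \<eta>)"
  have K: "0 \<le> K" using Lnorm_nonneg[of p M \<eta>] by (simp add: K_def)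
  have "\<forall>\<^sub>F \<epsilon> in at_right 0. Lnorm p M (\<lambda>\<omega>. (\<xi> \<epsilon> \<omega> - \<xi> 0 \<omega>) /\<^sub>R \<epsilon> - \<eta> \<omega>) < 1"
    using order_tendstoD(2)[OF lim, of 1] by simp
  moreover have "\<forall>\<^sub>F \<epsilon>::real in at_right 0. 0 < \<epsilon> \<and> \<epsilon> < 1"
    using eventually_at_right_real[of 0 1] by simp
  ultimately have ev: "\<forall>\<^sub>F \<epsilon> in at_right 0. Lnorm p M (\<lambda>\<omega>. \<xi> \<epsilon> \<omega> - \<xi> 0 \<omega>) \<le> K * \<epsilon>"
  proof eventually_elim
    case (elim \<epsilon>)
    let ?Z = "\<lambda>\<omega>. (\<xi> \<epsilon> \<omega> - \<xi> 0 \<omega>) /\<^sub>R \<epsilon>"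
    have Z: "?Z \<in> Lspace (ereal p) M"
      using elim by (intro Lspace_scaleR Lspace_diff p \<xi>) auto
    have "Lnorm p M (\<lambda>\<omega>. (?Z \<omega> - \<eta> \<omega>) + \<eta> \<omega>) \<le> 4 * (Lnorm p M (\<lambda>\<omega>. ?Z \<omega> - \<eta> \<omega>) + Lnorm p M \<eta>)"
      by (intro Lnorm_add_le Lspace_diff p Z \<eta>)
    also have "\<dots> \<le> K" using elim by (simp add: K_def)
    finally have "Lnorm p M ?Z \<le> K" by simp
    moreover have "Lnorm p M (\<lambda>\<omega>. \<epsilon> *\<^sub>R ?Z \<omega>) = \<bar>\<epsilon>\<bar> * Lnorm p M ?Z"
      using p by (intro Lnorm_scaleR) simp
    moreover have "(\<lambda>\<omega>. \<epsilon> *\<^sub>R ?Z \<omega>) = (\<lambda>\<omega>. \<xi> \<epsilon> \<omega> - \<xi> 0 \<omega>)"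
      using elim by auto
    ultimately show ?case
      using elim by (simp add: mult.commute mult_left_mono)
  qed
  have "((\<lambda>\<epsilon>. Lnorm p M (\<lambda>\<omega>. \<xi> \<epsilon> \<omega> - \<xi> 0 \<omega>)) \<longlongrightarrow> 0) (at_right 0)"
  proof (rule tendsto_sandwich[OF _ ev tendsto_const])
    have "((\<lambda>\<epsilon>. K * \<epsilon>) \<longlongrightarrow> K * 0) (at_right 0)" by (intro tendsto_intros)
    then show "((\<lambda>\<epsilon>. K * \<epsilon>) \<longlongrightarrow> 0) (at_right 0)" by simp
  qed (auto simp: Lnorm_nonneg)
  with K ev show ?thesis using that by blast
qed

text \<open>The remainder of the lift is small compared with the norm of
  \<open>\<xi> \<epsilon> - \<xi> 0\<close>, which is of order \<open>\<epsilon>\<close>, so it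
  disappears from the quotient; the linear part \<open>m\<close> converges because its direction
  does.\<close>

lemma (in prob_space) chain_rule_atomless:
  fixes \<xi> :: "real \<Rightarrow> 'a \<Rightarrow> 'b::{banach, second_countable_topology}"
  assumes p: "1 \<le> p" and f: "W_continuous p f" and \<xi>: "\<And>\<epsilon>. \<epsilon> \<in> {0..1} \<Longrightarrow> \<xi> \<epsilon> \<in> Lspace (ereal p) M"
    and deriv: "Lp_right_derivative p M \<xi> \<eta>"
    and no_atoms: "\<And>x. measure (distr M borel (\<xi> 0)) {x} = 0"
    and L: "has_L_derivative p f (distr M borel (\<xi> 0)) D"
    and V: "AE x in distr M borel (\<xi> 0). V x = D x" "continuous_on UNIV V" "growth_bound p C V" "0 \<le> C"
  shows "chain_rule M f \<xi> \<eta> V"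
proof -
  have \<xi>0: "\<xi> 0 \<in> Lspace (ereal p) M" using \<xi>[of 0] by simp
  have \<eta>: "\<eta> \<in> Lspace (ereal p) M"
    and lim: "((\<lambda>\<epsilon>. Lnorm p M (\<lambda>\<omega>. (\<xi> \<epsilon> \<omega> - \<xi> 0 \<omega>) /\<^sub>R \<epsilon> - \<eta> \<omega>)) \<longlongrightarrow> 0) (at_right 0)"
    using deriv by (auto simp: Lp_right_derivative_def)
  obtain K where K: "0 \<le> K" "\<forall>\<^sub>F \<epsilon> in at_right 0. Lnorm p M (\<lambda>\<omega>. \<xi> \<epsilon> \<omega> - \<xi> 0 \<omega>) \<le> K * \<epsilon>"
    and \<xi>_lim: "((\<lambda>\<epsilon>. Lnorm p M (\<lambda>\<omega>. \<xi> \<epsilon> \<omega> - \<xi> 0 \<omega>)) \<longlongrightarrow> 0) (at_right 0)"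
    using Lp_right_derivative_bound[OF p \<xi> deriv] by blast
  have unit: "\<forall>\<^sub>F \<epsilon>::real in at_right 0. 0 < \<epsilon> \<and> \<epsilon> < 1"
    using eventually_at_right_real[of 0 1] by simp
  define q where "q \<epsilon> = (f (distr M borel (\<xi> \<epsilon>)) - f (distr M borel (\<xi> 0))) / \<epsilon>" for \<epsilon>
  define m where "m \<epsilon> = (\<integral>\<omega>. blinfun_apply (V (\<xi> 0 \<omega>)) ((\<xi> \<epsilon> \<omega> - \<xi> 0 \<omega>) /\<^sub>R \<epsilon>) \<partial>M)" for \<epsilon>
  have law0: "distr M borel (\<xi> 0) \<in> Prob_p p"
    by (subst distr_in_Prob_p_iff) (use \<xi>0 in \<open>auto simp: Lspace_ereal_iff\<close>)
  have m_lim: "(m \<longlongrightarrow> (\<integral>\<omega>. blinfun_apply (V (\<xi> 0 \<omega>)) (\<eta> \<omega>) \<partial>M)) (at_right 0)"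
    unfolding m_def
  \<comment> \<open>A function \<open>V\<close> that ignores the law is jointly continuous on all of
    \<open>Prob_p p\<close>, and the point \<open>\<xi> 0\<close> is fixed as well: only the
    direction moves.\<close>
  proof (rule pairing_tendsto_at_right[where U="Prob_p p" and V="\<lambda>_. V" and Xs="\<lambda>_. \<xi> 0", OF p _ V(3,4) order_refl \<xi>0 \<eta> law0 _ _ lim])
    show "W_jointly_continuous_on p (Prob_p p) (\<lambda>_. V)"
      using V(2) unfolding W_jointly_continuous_on_def continuous_on_iff dist_norm by blast
    show "\<forall>\<^sub>F \<epsilon> in at_right 0. \<xi> 0 \<in> Lspace (ereal p) M \<and> (\<lambda>\<omega>. (\<xi> \<epsilon> \<omega> - \<xi> 0 \<omega>) /\<^sub>R \<epsilon>) \<in> Lspace (ereal p) M \<and> distr M borel (\<xi> 0) \<in> Prob_p p"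
      using unit by eventually_elim (use law0 \<xi>0 in \<open>auto intro!: Lspace_scaleR Lspace_diff p \<xi>\<close>)
    show "((\<lambda>\<epsilon>. Lnorm p M (\<lambda>\<omega>. \<xi> 0 \<omega> - \<xi> 0 \<omega>)) \<longlongrightarrow> 0) (at_right 0)"
      using p by (simp add: Lnorm_def)
  qed
  have "((\<lambda>\<epsilon>. q \<epsilon> - m \<epsilon>) \<longlongrightarrow> 0) (at_right 0)"
  proof (rule tendstoI)
    fix e :: real assume e: "0 < e"
    \<comment> \<open>\<open>K + 1\<close> is positive even if \<open>K\<close> vanishes, and it
      makes the final estimate strict.\<close>
    define e' where "e' = e / (K + 1)"
    have e': "0 < e'" using e K(1) by (simp add: e'_def)
    obtain d where d: "0 < d" "\<And>Y. Y \<in> Lspace (ereal p) M \<Longrightarrow> Lnorm p M (\<lambda>\<omega>. Y \<omega> - \<xi> 0 \<omega>) < d \<Longrightarrow>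
      \<bar>f (distr M borel Y) - f (distr M borel (\<xi> 0)) - (\<integral>\<omega>. blinfun_apply (V (\<xi> 0 \<omega>)) (Y \<omega> - \<xi> 0 \<omega>) \<partial>M)\<bar>
      \<le> e' * Lnorm p M (\<lambda>\<omega>. Y \<omega> - \<xi> 0 \<omega>)"
      using lift_differentiable[OF p f \<xi>0 no_atoms L V e'] by blast
    show "\<forall>\<^sub>F \<epsilon> in at_right 0. dist (q \<epsilon> - m \<epsilon>) 0 < e"
      using unit K(2) order_tendstoD(2)[OF \<xi>_lim d(1)]
    proof eventually_elim
      case (elim \<epsilon>)
      have "(\<integral>\<omega>. blinfun_apply (V (\<xi> 0 \<omega>)) (\<xi> \<epsilon> \<omega> - \<xi> 0 \<omega>) \<partial>M) = \<epsilon> * m \<epsilon>"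
        using elim by (simp add: m_def blinfun.scaleR_right)
      then have "\<bar>\<epsilon> * q \<epsilon> - \<epsilon> * m \<epsilon>\<bar> \<le> e' * Lnorm p M (\<lambda>\<omega>. \<xi> \<epsilon> \<omega> - \<xi> 0 \<omega>)"
        using d(2)[of "\<xi> \<epsilon>"] \<xi>[of \<epsilon>] elim by (simp add: q_def)
      also have "\<dots> \<le> e' * (K * \<epsilon>)"
        using elim e' by (intro mult_left_mono) auto
      also have "\<bar>\<epsilon> * q \<epsilon> - \<epsilon> * m \<epsilon>\<bar> = \<epsilon> * \<bar>q \<epsilon> - m \<epsilon>\<bar>"
        using elim by (simp add: abs_mult flip: right_diff_distrib)
      finally have "\<epsilon> * \<bar>q \<epsilon> - m \<epsilon>\<bar> \<le> \<epsilon> * (e' * K)" by (simp add: mult_ac)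
      then have "\<bar>q \<epsilon> - m \<epsilon>\<bar> \<le> e' * K" using elim by simp
      also have "\<dots> < e' * (K + 1)" using e' by simp
      also have "\<dots> = e" using K(1) by (simp add: e'_def)
      finally show ?case by (simp add: dist_real_def)
    qed
  qed
  from tendsto_add[OF this m_lim] have "(q \<longlongrightarrow> (\<integral>\<omega>. blinfun_apply (V (\<xi> 0 \<omega>)) (\<eta> \<omega>) \<partial>M)) (at_right 0)"
    by simp
  then show ?thesis
    using growth_bound_integrable(1)[OF V(2,3) p V(4) \<xi>0 \<eta>] by (simp add: chain_rule_def q_def[abs_def])
qed

lemma (in prob_space) lift_mean_value:
  fixes X Z :: "'a \<Rightarrow> 'b::{banach, second_countable_topology}"
  assumes p: "1 \<le> p" and f: "W_continuous p f" and X: "X \<in> Lspace (ereal p) M" and Z: "Z \<in> Lspace (ereal p) M"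
    and L: "\<And>\<mu>. \<mu> \<in> U \<Longrightarrow> has_L_derivative p f \<mu> (D \<mu>)"
    and V: "\<And>\<mu>. \<mu> \<in> U \<Longrightarrow> AE x in \<mu>. V \<mu> x = D \<mu> x" "\<And>\<mu>. \<mu> \<in> U \<Longrightarrow> continuous_on UNIV (V \<mu>)"
      "\<And>\<mu>. \<mu> \<in> U \<Longrightarrow> growth_bound p C (V \<mu>)" "0 \<le> C"
    and segment: "\<And>t. t \<in> {0..1} \<Longrightarrow> distr M borel (\<lambda>\<omega>. X \<omega> + t *\<^sub>R Z \<omega>) \<in> U"
    and no_atoms: "\<And>t x. t \<in> {0..1} \<Longrightarrow> measure (distr M borel (\<lambda>\<omega>. X \<omega> + t *\<^sub>R Z \<omega>)) {x} = 0"
  obtains t where "t \<in> {0..1}" "f (distr M borel (\<lambda>\<omega>. X \<omega> + Z \<omega>)) - f (distr M borel X)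
    = (\<integral>\<omega>. blinfun_apply (V (distr M borel (\<lambda>\<omega>. X \<omega> + t *\<^sub>R Z \<omega>)) (X \<omega> + t *\<^sub>R Z \<omega>)) (Z \<omega>) \<partial>M)"
proof -
  define Y where "Y t \<omega> = X \<omega> + t *\<^sub>R Z \<omega>" for t \<omega>
  have Y: "Y t \<in> Lspace (ereal p) M" for t
    unfolding Y_def by (intro Lspace_add Lspace_scaleR p X Z)
  define F where "F t = f (distr M borel (Y t))" for t
  define I where "I t = (\<integral>\<omega>. blinfun_apply (V (distr M borel (Y t)) (Y t \<omega>)) (Z \<omega>) \<partial>M)" for t
  \<comment> \<open>The derivative is two-sided even at \<open>t = 0\<close> and
    \<open>t = 1\<close>: \<open>Y s\<close> is defined for all real \<open>s\<close>, and
    \<open>lift_differentiable\<close> asks of the nearby variable only that it lie in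
    \<open>L\<^sup>p\<close>.\<close>
  have "(F has_real_derivative I t) (at t)" if t: "0 \<le> t" "t \<le> 1" for t
    unfolding has_field_derivative_def has_derivative_within_alt
  proof (intro conjI allI impI)
    show "bounded_linear ((*) (I t))" by (rule bounded_linear_mult_right)
    fix e :: real assume e: "0 < e"
    define N where "N = Lnorm p M Z"
    have N: "0 \<le> N" unfolding N_def by (rule Lnorm_nonneg)
    define e' where "e' = e / (N + 1)"
    have e': "0 < e'" using e N by (simp add: e'_def)
    have tU: "distr M borel (Y t) \<in> U" and at: "measure (distr M borel (Y t)) {x} = 0" for x
      using segment[of t] no_atoms[of t] t by (simp_all add: Y_def[abs_def])
    obtain d where d: "0 < d" "\<And>Y'. Y' \<in> Lspace (ereal p) M \<Longrightarrow> Lnorm p M (\<lambda>\<omega>. Y' \<omega> - Y t \<omega>) < d \<Longrightarrow>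
      \<bar>f (distr M borel Y') - f (distr M borel (Y t)) - (\<integral>\<omega>. blinfun_apply (V (distr M borel (Y t)) (Y t \<omega>)) (Y' \<omega> - Y t \<omega>) \<partial>M)\<bar>
      \<le> e' * Lnorm p M (\<lambda>\<omega>. Y' \<omega> - Y t \<omega>)"
      using lift_differentiable[OF p f Y at L[OF tU] V(1-3)[OF tU] V(4) e'] by blast
    show "\<exists>d>0. \<forall>s\<in>UNIV. norm (s - t) < d \<longrightarrow> norm (F s - F t - I t * (s - t)) \<le> e * norm (s - t)"
    proof (intro exI conjI ballI impI)
      show "0 < d / (N + 1)" using d N by simp
      fix s assume s: "norm (s - t) < d / (N + 1)"
      have diff: "Y s \<omega> - Y t \<omega> = (s - t) *\<^sub>R Z \<omega>" for \<omega>
        by (simp add: Y_def algebra_simps)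
      have norm_eq: "Lnorm p M (\<lambda>\<omega>. Y s \<omega> - Y t \<omega>) = \<bar>s - t\<bar> * N"
        unfolding diff N_def using p by (intro Lnorm_scaleR) simp
      have "\<bar>s - t\<bar> * N \<le> \<bar>s - t\<bar> * (N + 1)"
        by (intro mult_left_mono) auto
      also have "\<dots> < d"
        using s N by (simp add: pos_less_divide_eq)
      finally have "\<bar>F s - F t - (\<integral>\<omega>. blinfun_apply (V (distr M borel (Y t)) (Y t \<omega>)) (Y s \<omega> - Y t \<omega>) \<partial>M)\<bar> \<le> e' * (\<bar>s - t\<bar> * N)"
        unfolding F_def norm_eq[symmetric] by (intro d(2) Y)
      also have "(\<integral>\<omega>. blinfun_apply (V (distr M borel (Y t)) (Y t \<omega>)) (Y s \<omega> - Y t \<omega>) \<partial>M) = I t * (s - t)"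
        by (simp add: diff I_def blinfun.scaleR_right)
      also have "e' * (\<bar>s - t\<bar> * N) \<le> e' * (\<bar>s - t\<bar> * (N + 1))"
        using e' by (intro mult_left_mono) auto
      also have "\<dots> = e * \<bar>s - t\<bar>"
        using N by (simp add: e'_def)
      finally show "norm (F s - F t - I t * (s - t)) \<le> e * norm (s - t)" by simp
    qed
  qed
  then obtain t where t: "0 < t" "t < 1" "F 1 - F 0 = (1 - 0) * I t"
    using MVT2[of 0 1 F I] by auto
  show ?thesis
    by (rule that[of t]) (use t in \<open>auto simp: F_def I_def Y_def[abs_def]\<close>)
qed

text \<open>The noise \<open>W\<close> enters through two properties only: it lies in
  \<open>L\<^sup>p\<close>, and every positive multiple of it removes the atoms along the whole line
  through \<open>\<xi> 0\<close> and \<open>\<xi> \<epsilon>\<close>.\<close>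

lemma (in prob_space) chain_rule_with_noise:
  fixes \<xi> :: "real \<Rightarrow> 'a \<Rightarrow> 'b::{banach, second_countable_topology}"
  assumes p: "1 \<le> p" and f: "W_continuous p f" and \<xi>: "\<And>\<epsilon>. \<epsilon> \<in> {0..1} \<Longrightarrow> \<xi> \<epsilon> \<in> Lspace (ereal p) M"
    and deriv: "Lp_right_derivative p M \<xi> \<eta>"
    and U: "W_neighbourhood p (distr M borel (\<xi> 0)) U"
    and L: "\<And>\<mu>. \<mu> \<in> U \<Longrightarrow> has_L_derivative p f \<mu> (D \<mu>)"
    and V: "\<And>\<mu>. \<mu> \<in> U \<Longrightarrow> AE x in \<mu>. V \<mu> x = D \<mu> x" "W_jointly_continuous_on p U V"
      "\<And>\<mu>. \<mu> \<in> U \<Longrightarrow> growth_bound p C (V \<mu>)" "0 \<le> C"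
    and W: "W \<in> Lspace (ereal p) M"
    and no_atoms: "\<And>\<epsilon> s t x. \<epsilon> \<in> {0..1} \<Longrightarrow> 0 < s \<Longrightarrow>
      measure (distr M borel (\<lambda>\<omega>. (\<xi> 0 \<omega> + s *\<^sub>R W \<omega>) + t *\<^sub>R (\<xi> \<epsilon> \<omega> - \<xi> 0 \<omega>))) {x} = 0"
  shows "chain_rule M f \<xi> \<eta> (V (distr M borel (\<xi> 0)))"
proof -
  let ?\<mu> = "distr M borel (\<xi> 0)"
  have p0: "0 < p" using p by simp
  have \<xi>0: "\<xi> 0 \<in> Lspace (ereal p) M" using \<xi>[of 0] by simp
  have \<xi>0m: "\<xi> 0 \<in> borel_measurable M" using \<xi>0 by (simp add: Lspace_ereal_iff)
  have law0: "?\<mu> \<in> Prob_p p"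
    using \<xi>0 by (subst distr_in_Prob_p_iff) (auto simp: Lspace_ereal_iff)
  obtain r where r: "0 < r" "\<And>\<nu>. \<nu> \<in> Prob_p p \<Longrightarrow> Wasserstein p ?\<mu> \<nu> < r \<Longrightarrow> \<nu> \<in> U" and U_sub: "U \<subseteq> Prob_p p"
    using U unfolding W_neighbourhood_def by blast
  have law_in_U: "distr M borel Y \<in> U" if "Y \<in> Lspace (ereal p) M" "Lnorm p M (\<lambda>\<omega>. Y \<omega> - \<xi> 0 \<omega>) < r" for Y
  proof (rule r(2))
    have Ym: "Y \<in> borel_measurable M" using that by (simp add: Lspace_ereal_iff)
    show "distr M borel Y \<in> Prob_p p"
      using that by (simp add: distr_in_Prob_p_iff[OF Ym])
    show "Wasserstein p ?\<mu> (distr M borel Y) < r"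
      using Wasserstein_distr_le[OF \<xi>0m Ym, of p] that(2) by (simp add: Lnorm_minus_commute[of p M Y])
  qed
  have \<mu>U: "?\<mu> \<in> U"
    using law_in_U[OF \<xi>0] r(1) p0 by (simp add: Lnorm_def)
  have Vc: "continuous_on UNIV (V \<mu>)" if "\<mu> \<in> U" for \<mu>
    using W_jointly_continuous_on_imp_continuous_on[OF V(2) that U_sub p0] .
  have \<eta>: "\<eta> \<in> Lspace (ereal p) M"
    and lim: "((\<lambda>\<epsilon>. Lnorm p M (\<lambda>\<omega>. (\<xi> \<epsilon> \<omega> - \<xi> 0 \<omega>) /\<^sub>R \<epsilon> - \<eta> \<omega>)) \<longlongrightarrow> 0) (at_right 0)"
    using deriv by (auto simp: Lp_right_derivative_def)
  have \<xi>_lim: "((\<lambda>\<epsilon>. Lnorm p M (\<lambda>\<omega>. \<xi> \<epsilon> \<omega> - \<xi> 0 \<omega>)) \<longlongrightarrow> 0) (at_right 0)"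
    using Lp_right_derivative_bound[OF p \<xi> deriv] by blast
  define N where "N \<epsilon> = Lnorm p M (\<lambda>\<omega>. \<xi> \<epsilon> \<omega> - \<xi> 0 \<omega>)" for \<epsilon>
  define w where "w = Lnorm p M W"
  have w: "0 \<le> w" and N: "0 \<le> N \<epsilon>" for \<epsilon> unfolding w_def N_def by (auto simp: Lnorm_nonneg)
  have unit: "\<forall>\<^sub>F \<epsilon>::real in at_right 0. 0 < \<epsilon> \<and> \<epsilon> < 1"
    using eventually_at_right_real[of 0 1] by simp
  have bd_lim: "((\<lambda>\<epsilon>. 4 * (\<epsilon> * w + N \<epsilon>)) \<longlongrightarrow> 0) (at_right 0)"
  proof -
    have "((\<lambda>\<epsilon>. 4 * (\<epsilon> * w + N \<epsilon>)) \<longlongrightarrow> 4 * (0 * w + 0)) (at_right 0)"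
      using \<xi>_lim unfolding N_def by (intro tendsto_intros)
    then show ?thesis by simp
  qed
  define q where "q \<epsilon> = (f (distr M borel (\<xi> \<epsilon>)) - f ?\<mu>) / \<epsilon>" for \<epsilon>
  define m where "m Y \<epsilon> = (\<integral>\<omega>. blinfun_apply (V (distr M borel Y) (Y \<omega>)) ((\<xi> \<epsilon> \<omega> - \<xi> 0 \<omega>) /\<^sub>R \<epsilon>) \<partial>M)" for Y \<epsilon>
  \<comment> \<open>\<open>Y\<close> stands for the intermediate point of the mean value theorem.
    Recorded is what the limit needs: its law stays in \<open>U\<close>, it tends to
    \<open>\<xi> 0\<close>, and the quotient is within \<open>2 * \<epsilon>\<close> of the pairing
    at \<open>Y\<close>.\<close>
  define good where "good \<epsilon> Y \<longleftrightarrow> Y \<in> Lspace (ereal p) M \<and> distr M borel Y \<in> U \<and>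
    Lnorm p M (\<lambda>\<omega>. Y \<omega> - \<xi> 0 \<omega>) \<le> 4 * (\<epsilon> * w + N \<epsilon>) \<and> \<bar>q \<epsilon> - m Y \<epsilon>\<bar> \<le> 2 * \<epsilon>" for \<epsilon> Y
  have perturb: "\<exists>d>0. \<forall>s. 0 < s \<and> s < d \<longrightarrow> \<bar>f (distr M borel (\<lambda>\<omega>. Y \<omega> + s *\<^sub>R W \<omega>)) - f (distr M borel Y)\<bar> < c"
    if Y: "Y \<in> Lspace (ereal p) M" and c: "0 < c" for Y c
  proof -
    have Ym: "Y \<in> borel_measurable M" using Y by (simp add: Lspace_ereal_iff)
    have "distr M borel Y \<in> Prob_p p"
      using Y by (simp add: distr_in_Prob_p_iff[OF Ym])
    then obtain d where d: "0 < d" "\<And>\<nu>. \<nu> \<in> Prob_p p \<Longrightarrow> Wasserstein p (distr M borel Y) \<nu> < d \<Longrightarrow> \<bar>f \<nu> - f (distr M borel Y)\<bar> < c"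
      using f c unfolding W_continuous_def by meson
    have "\<bar>f (distr M borel (\<lambda>\<omega>. Y \<omega> + s *\<^sub>R W \<omega>)) - f (distr M borel Y)\<bar> < c" if s: "0 < s" "s < d / (w + 1)" for s
    proof (rule d(2))
      have YW: "(\<lambda>\<omega>. Y \<omega> + s *\<^sub>R W \<omega>) \<in> Lspace (ereal p) M"
        by (intro Lspace_add Lspace_scaleR p Y W)
      then have YWm: "(\<lambda>\<omega>. Y \<omega> + s *\<^sub>R W \<omega>) \<in> borel_measurable M" by (simp add: Lspace_ereal_iff)
      show "distr M borel (\<lambda>\<omega>. Y \<omega> + s *\<^sub>R W \<omega>) \<in> Prob_p p"
        using YW by (simp add: distr_in_Prob_p_iff[OF YWm])
      have "Wasserstein p (distr M borel Y) (distr M borel (\<lambda>\<omega>. Y \<omega> + s *\<^sub>R W \<omega>)) \<le> Lnorm p M (\<lambda>\<omega>. Y \<omega> - (Y \<omega> + s *\<^sub>R W \<omega>))"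
        by (rule Wasserstein_distr_le[OF Ym YWm])
      also have "\<dots> = Lnorm p M (\<lambda>\<omega>. (- s) *\<^sub>R W \<omega>)" by simp
      also have "\<dots> = s * w"
        using s Lnorm_scaleR[OF p0, of M "- s" W] by (simp add: w_def)
      also have "\<dots> \<le> s * (w + 1)" using s by simp
      also have "\<dots> < d" using s w by (simp add: pos_less_divide_eq)
      finally show "Wasserstein p (distr M borel Y) (distr M borel (\<lambda>\<omega>. Y \<omega> + s *\<^sub>R W \<omega>)) < d" .
    qed
    then show ?thesis using d(1) w by (intro exI[of _ "d / (w + 1)"]) auto
  qed
  have "\<forall>\<^sub>F \<epsilon> in at_right 0. \<exists>Y. good \<epsilon> Y"
    using unit order_tendstoD(2)[OF bd_lim r(1)]
  proof eventually_elim
    case (elim \<epsilon>)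
    have \<xi>\<epsilon>: "\<xi> \<epsilon> \<in> Lspace (ereal p) M" using elim by (intro \<xi>) auto
    \<comment> \<open>The noise is added at both ends and changes \<open>f\<close> by less than
      \<open>\<epsilon> * \<epsilon>\<close> each time; after division by \<open>\<epsilon>\<close>
      this leaves the \<open>2 * \<epsilon>\<close> in \<open>good\<close>.\<close>
    have c: "0 < \<epsilon> * \<epsilon>" using elim by simp
    obtain d1 where d1: "0 < d1" "\<And>s. 0 < s \<Longrightarrow> s < d1 \<Longrightarrow> \<bar>f (distr M borel (\<lambda>\<omega>. \<xi> \<epsilon> \<omega> + s *\<^sub>R W \<omega>)) - f (distr M borel (\<xi> \<epsilon>))\<bar> < \<epsilon> * \<epsilon>"
      using perturb[OF \<xi>\<epsilon> c] by blast
    obtain d2 where d2: "0 < d2" "\<And>s. 0 < s \<Longrightarrow> s < d2 \<Longrightarrow> \<bar>f (distr M borel (\<lambda>\<omega>. \<xi> 0 \<omega> + s *\<^sub>R W \<omega>)) - f ?\<mu>\<bar> < \<epsilon> * \<epsilon>"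
      using perturb[OF \<xi>0 c] by blast
    \<comment> \<open>Halving makes the inequalities strict; \<open>s < \<epsilon>\<close> keeps the
      noise from spoiling the convergence of \<open>Y\<close> to \<open>\<xi> 0\<close>.\<close>
    define s where "s = Min {d1, d2, \<epsilon>} / 2"
    have s: "0 < s" "s < d1" "s < d2" "s < \<epsilon>"
      using d1(1) d2(1) elim by (auto simp: s_def min_def)
    define X where "X \<omega> = \<xi> 0 \<omega> + s *\<^sub>R W \<omega>" for \<omega>
    define Z where "Z \<omega> = \<xi> \<epsilon> \<omega> - \<xi> 0 \<omega>" for \<omega>
    have X: "X \<in> Lspace (ereal p) M"
      unfolding X_def by (intro Lspace_add Lspace_scaleR p \<xi>0 W)
    have Z: "Z \<in> Lspace (ereal p) M"
      unfolding Z_def by (intro Lspace_diff p \<xi>\<epsilon> \<xi>0)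
    have Y: "(\<lambda>\<omega>. X \<omega> + t *\<^sub>R Z \<omega>) \<in> Lspace (ereal p) M" for t
      by (intro Lspace_add Lspace_scaleR p X Z)
    have near: "Lnorm p M (\<lambda>\<omega>. (X \<omega> + t *\<^sub>R Z \<omega>) - \<xi> 0 \<omega>) \<le> 4 * (\<epsilon> * w + N \<epsilon>)" if t: "t \<in> {0..1}" for t
    proof -
      have "Lnorm p M (\<lambda>\<omega>. (X \<omega> + t *\<^sub>R Z \<omega>) - \<xi> 0 \<omega>) = Lnorm p M (\<lambda>\<omega>. s *\<^sub>R W \<omega> + t *\<^sub>R Z \<omega>)"
        by (simp add: X_def)
      also have "\<dots> \<le> 4 * (Lnorm p M (\<lambda>\<omega>. s *\<^sub>R W \<omega>) + Lnorm p M (\<lambda>\<omega>. t *\<^sub>R Z \<omega>))"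
        by (intro Lnorm_add_le Lspace_scaleR p W Z)
      also have "\<dots> = 4 * (s * w + t * N \<epsilon>)"
        using s t by (simp add: Lnorm_scaleR[OF p0] w_def N_def Z_def[abs_def])
      also have "\<dots> \<le> 4 * (\<epsilon> * w + 1 * N \<epsilon>)"
        using s t w N by (intro mult_left_mono add_mono mult_right_mono) auto
      finally show ?thesis by simp
    qed
    have in_U: "distr M borel (\<lambda>\<omega>. X \<omega> + t *\<^sub>R Z \<omega>) \<in> U" if t: "t \<in> {0..1}" for t
      using near[OF t] elim by (intro law_in_U Y) linarith
    have at: "measure (distr M borel (\<lambda>\<omega>. X \<omega> + t *\<^sub>R Z \<omega>)) {x} = 0" for t x
      using no_atoms[of \<epsilon> s t x] elim s by (simp add: X_def Z_def)
    obtain t where t: "t \<in> {0..1}" "f (distr M borel (\<lambda>\<omega>. X \<omega> + Z \<omega>)) - f (distr M borel X)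
      = (\<integral>\<omega>. blinfun_apply (V (distr M borel (\<lambda>\<omega>. X \<omega> + t *\<^sub>R Z \<omega>)) (X \<omega> + t *\<^sub>R Z \<omega>)) (Z \<omega>) \<partial>M)"
      using lift_mean_value[OF p f X Z L V(1) Vc V(3,4) in_U at] by blast
    have "(\<integral>\<omega>. blinfun_apply (V (distr M borel (\<lambda>\<omega>. X \<omega> + t *\<^sub>R Z \<omega>)) (X \<omega> + t *\<^sub>R Z \<omega>)) (Z \<omega>) \<partial>M)
      = \<epsilon> * m (\<lambda>\<omega>. X \<omega> + t *\<^sub>R Z \<omega>) \<epsilon>"
      using elim by (simp add: m_def Z_def blinfun.scaleR_right)
    moreover have "(\<lambda>\<omega>. X \<omega> + Z \<omega>) = (\<lambda>\<omega>. \<xi> \<epsilon> \<omega> + s *\<^sub>R W \<omega>)"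
      by (simp add: X_def Z_def add.commute)
    moreover have "X = (\<lambda>\<omega>. \<xi> 0 \<omega> + s *\<^sub>R W \<omega>)"
      by (simp add: X_def[abs_def])
    moreover have "f (distr M borel (\<xi> \<epsilon>)) - f ?\<mu> = \<epsilon> * q \<epsilon>"
      using elim by (simp add: q_def)
    ultimately have "\<bar>\<epsilon> * q \<epsilon> - \<epsilon> * m (\<lambda>\<omega>. X \<omega> + t *\<^sub>R Z \<omega>) \<epsilon>\<bar> \<le> 2 * (\<epsilon> * \<epsilon>)"
      using d1(2)[OF s(1,2)] d2(2)[OF s(1,3)] t(2) by simp
    moreover have "\<bar>\<epsilon> * q \<epsilon> - \<epsilon> * m (\<lambda>\<omega>. X \<omega> + t *\<^sub>R Z \<omega>) \<epsilon>\<bar> = \<epsilon> * \<bar>q \<epsilon> - m (\<lambda>\<omega>. X \<omega> + t *\<^sub>R Z \<omega>) \<epsilon>\<bar>"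
      using elim by (simp add: abs_mult flip: right_diff_distrib)
    ultimately have "\<epsilon> * \<bar>q \<epsilon> - m (\<lambda>\<omega>. X \<omega> + t *\<^sub>R Z \<omega>) \<epsilon>\<bar> \<le> \<epsilon> * (2 * \<epsilon>)" by simp
    then have "\<bar>q \<epsilon> - m (\<lambda>\<omega>. X \<omega> + t *\<^sub>R Z \<omega>) \<epsilon>\<bar> \<le> 2 * \<epsilon>"
      using elim by simp
    then have "good \<epsilon> (\<lambda>\<omega>. X \<omega> + t *\<^sub>R Z \<omega>)"
      unfolding good_def using Y in_U[OF t(1)] near[OF t(1)] by blast
    then show ?case by blast
  qed
  \<comment> \<open>The intermediate point depends on \<open>\<epsilon>\<close> without any
    regularity, so it is merely chosen; the limit uses nothing but \<open>good\<close>.\<close>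
  then have ev: "\<forall>\<^sub>F \<epsilon> in at_right 0. good \<epsilon> (SOME Y. good \<epsilon> Y)"
  proof eventually_elim
    case (elim \<epsilon>)
    then show ?case by (rule someI_ex[of "good \<epsilon>"])
  qed
  define Y where "Y \<epsilon> = (SOME Y. good \<epsilon> Y)" for \<epsilon>
  have good: "\<forall>\<^sub>F \<epsilon> in at_right 0. good \<epsilon> (Y \<epsilon>)"
    using ev by (simp add: Y_def)
  have m_lim: "((\<lambda>\<epsilon>. m (Y \<epsilon>) \<epsilon>) \<longlongrightarrow> (\<integral>\<omega>. blinfun_apply (V ?\<mu> (\<xi> 0 \<omega>)) (\<eta> \<omega>) \<partial>M)) (at_right 0)"
    unfolding m_def
  proof (rule pairing_tendsto_at_right[OF p V(2,3,4) U_sub \<xi>0 \<eta> \<mu>U _ _ lim])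
    show "\<forall>\<^sub>F \<epsilon> in at_right 0. Y \<epsilon> \<in> Lspace (ereal p) M \<and> (\<lambda>\<omega>. (\<xi> \<epsilon> \<omega> - \<xi> 0 \<omega>) /\<^sub>R \<epsilon>) \<in> Lspace (ereal p) M \<and> distr M borel (Y \<epsilon>) \<in> U"
      using unit good by eventually_elim (auto simp: good_def intro!: Lspace_scaleR Lspace_diff p \<xi>)
    have up: "\<forall>\<^sub>F \<epsilon> in at_right 0. Lnorm p M (\<lambda>\<omega>. Y \<epsilon> \<omega> - \<xi> 0 \<omega>) \<le> 4 * (\<epsilon> * w + N \<epsilon>)"
      using good by eventually_elim (simp add: good_def)
    show "((\<lambda>\<epsilon>. Lnorm p M (\<lambda>\<omega>. Y \<epsilon> \<omega> - \<xi> 0 \<omega>)) \<longlongrightarrow> 0) (at_right 0)"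
      by (rule tendsto_sandwich[OF _ up tendsto_const bd_lim]) (auto simp: Lnorm_nonneg)
  qed
  have "((\<lambda>\<epsilon>. q \<epsilon> - m (Y \<epsilon>) \<epsilon>) \<longlongrightarrow> 0) (at_right 0)"
  proof (rule Lim_null_comparison)
    show "\<forall>\<^sub>F \<epsilon> in at_right 0. norm (q \<epsilon> - m (Y \<epsilon>) \<epsilon>) \<le> 2 * \<epsilon>"
      using good by eventually_elim (simp add: good_def)
    have "((\<lambda>\<epsilon>::real. 2 * \<epsilon>) \<longlongrightarrow> 2 * 0) (at_right 0)" by (intro tendsto_intros)
    then show "((\<lambda>\<epsilon>::real. 2 * \<epsilon>) \<longlongrightarrow> 0) (at_right 0)" by simp
  qed
  from tendsto_add[OF this m_lim] have "(q \<longlongrightarrow> (\<integral>\<omega>. blinfun_apply (V ?\<mu> (\<xi> 0 \<omega>)) (\<eta> \<omega>) \<partial>M)) (at_right 0)"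
    by simp
  then show ?thesis
    using growth_bound_integrable(1)[OF Vc[OF \<mu>U] V(3)[OF \<mu>U] p V(4) \<xi>0 \<eta>] by (simp add: chain_rule_def q_def[abs_def])
qed

subsection \<open>Removing atoms by independent noise\<close>

lemma atomless_measure_singleton:
  assumes "atomless \<mu>" "{x} \<in> sets \<mu>"
  shows "measure \<mu> {x} = 0"
proof (rule ccontr)
  assume "measure \<mu> {x} \<noteq> 0"
  then have "0 < emeasure \<mu> {x}"
    by (metis enn2real_0 measure_def not_gr_zero)
  then obtain B where "B \<subseteq> {x}" "0 < emeasure \<mu> B" "emeasure \<mu> B < emeasure \<mu> {x}"
    using assms unfolding atomless_def by blast
  then show False by (auto simp: subset_singleton_iff)
qed

text \<open>A null set for the law of \<open>\<xi> 0\<close> pulls back to a null set of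
  \<open>M\<close>, so every representative of the derivative gives the same expectation.\<close>

lemma (in prob_space) chain_rule_cong_AE:
  assumes V: "chain_rule M f \<xi> \<eta> V" "continuous_on UNIV V"
    and D: "D \<in> borel_measurable (distr M borel (\<xi> 0))" "AE x in distr M borel (\<xi> 0). V x = D x"
    and meas[measurable]: "\<xi> 0 \<in> borel_measurable M" "\<eta> \<in> borel_measurable M"
  shows "chain_rule M f \<xi> \<eta> D"
proof -
  have [measurable]: "V \<in> borel_measurable borel" "D \<in> borel_measurable borel"
    using V(2) D(1) by (auto intro: borel_measurable_continuous_onI)
  have m: "(\<lambda>\<omega>. blinfun_apply (V (\<xi> 0 \<omega>)) (\<eta> \<omega>)) \<in> borel_measurable M"
    "(\<lambda>\<omega>. blinfun_apply (D (\<xi> 0 \<omega>)) (\<eta> \<omega>)) \<in> borel_measurable M"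
    by (auto intro!: blinfun_apply_measurable)
  have "AE \<omega> in M. V (\<xi> 0 \<omega>) = D (\<xi> 0 \<omega>)"
    using AE_distrD[OF meas(1) D(2)] .
  then have AE: "AE \<omega> in M. blinfun_apply (V (\<xi> 0 \<omega>)) (\<eta> \<omega>) = blinfun_apply (D (\<xi> 0 \<omega>)) (\<eta> \<omega>)"
    by eventually_elim simp
  show ?thesis
    using V(1) integrable_cong_AE[OF m AE] integral_cong_AE[OF m AE] by (simp add: chain_rule_def)
qed

section \<open>Pulling random variables back along a measure-preserving map\<close>

lemma distr_measure_preserving:
  assumes "\<phi> \<in> measurable N M" "distr N M \<phi> = M" "X \<in> borel_measurable M"
  shows "distr N borel (\<lambda>z. X (\<phi> z)) = distr M borel X"
  using distr_distr[OF assms(3,1)] assms(2) by (simp add: comp_def)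

lemma integrable_measure_preserving:
  fixes g :: "'a \<Rightarrow> 'c::{banach, second_countable_topology}"
  assumes "\<phi> \<in> measurable N M" "distr N M \<phi> = M" "g \<in> borel_measurable M"
  shows "integrable N (\<lambda>z. g (\<phi> z)) \<longleftrightarrow> integrable M g"
  using integrable_distr_eq[OF assms(1,3)] assms(2) by simp

lemma integral_measure_preserving:
  fixes g :: "'a \<Rightarrow> 'c::{banach, second_countable_topology}"
  assumes "\<phi> \<in> measurable N M" "distr N M \<phi> = M" "g \<in> borel_measurable M"
  shows "(\<integral>z. g (\<phi> z) \<partial>N) = (\<integral>x. g x \<partial>M)"
  using integral_distr[OF assms(1,3)] assms(2) by simp

lemma Lspace_measure_preserving:
  fixes X :: "'a \<Rightarrow> 'b::{banach, second_countable_topology}"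
  assumes \<phi>: "\<phi> \<in> measurable N M" "distr N M \<phi> = M" and X: "X \<in> Lspace (ereal p) M"
  shows "(\<lambda>z. X (\<phi> z)) \<in> Lspace (ereal p) N"
  using X integrable_measure_preserving[OF \<phi>, of "\<lambda>x. norm (X x) powr p"] \<phi>(1)
  by (auto simp: Lspace_ereal_iff)

lemma Lnorm_measure_preserving:
  fixes X :: "'a \<Rightarrow> 'b::{banach, second_countable_topology}"
  assumes \<phi>: "\<phi> \<in> measurable N M" "distr N M \<phi> = M" and X: "X \<in> Lspace (ereal p) M"
  shows "Lnorm p N (\<lambda>z. X (\<phi> z)) = Lnorm p M X"
proof -
  have [measurable]: "X \<in> borel_measurable M"
    using X by (simp add: Lspace_ereal_iff)
  have "(\<lambda>x. norm (X x) powr p) \<in> borel_measurable M" by measurable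
  from integral_measure_preserving[OF \<phi> this] show ?thesis
    by (simp add: Lnorm_def)
qed

lemma Lp_right_derivative_measure_preserving:
  fixes \<xi> :: "real \<Rightarrow> 'a \<Rightarrow> 'b::{banach, second_countable_topology}"
  assumes p: "1 \<le> p" and \<phi>: "\<phi> \<in> measurable N M" "distr N M \<phi> = M"
    and \<xi>: "\<And>\<epsilon>. \<epsilon> \<in> {0..1} \<Longrightarrow> \<xi> \<epsilon> \<in> Lspace (ereal p) M" and deriv: "Lp_right_derivative p M \<xi> \<eta>"
  shows "Lp_right_derivative p N (\<lambda>\<epsilon> z. \<xi> \<epsilon> (\<phi> z)) (\<lambda>z. \<eta> (\<phi> z))"
proof -
  have \<eta>: "\<eta> \<in> Lspace (ereal p) M"
    and lim: "((\<lambda>\<epsilon>. Lnorm p M (\<lambda>\<omega>. (\<xi> \<epsilon> \<omega> - \<xi> 0 \<omega>) /\<^sub>R \<epsilon> - \<eta> \<omega>)) \<longlongrightarrow> 0) (at_right 0)"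
    using deriv by (auto simp: Lp_right_derivative_def)
  \<comment> \<open>Only for \<open>\<epsilon>\<close> in the unit interval is
    \<open>\<xi> \<epsilon>\<close> known to lie in \<open>L\<^sup>p\<close>.\<close>
  have "\<forall>\<^sub>F \<epsilon>::real in at_right 0. \<epsilon> \<in> {0<..<1}"
    by (rule eventually_at_right_real) simp
  then have "\<forall>\<^sub>F \<epsilon> in at_right 0. Lnorm p M (\<lambda>\<omega>. (\<xi> \<epsilon> \<omega> - \<xi> 0 \<omega>) /\<^sub>R \<epsilon> - \<eta> \<omega>)
      = Lnorm p N (\<lambda>z. (\<xi> \<epsilon> (\<phi> z) - \<xi> 0 (\<phi> z)) /\<^sub>R \<epsilon> - \<eta> (\<phi> z))"
  proof eventually_elim
    case (elim \<epsilon>)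
    have "(\<lambda>\<omega>. (\<xi> \<epsilon> \<omega> - \<xi> 0 \<omega>) /\<^sub>R \<epsilon> - \<eta> \<omega>) \<in> Lspace (ereal p) M"
      using elim by (intro Lspace_diff Lspace_scaleR p \<xi> \<eta>) auto
    from Lnorm_measure_preserving[OF \<phi> this] show ?case by simp
  qed
  then show ?thesis
    using Lspace_measure_preserving[OF \<phi> \<eta>] lim tendsto_cong by (fastforce simp: Lp_right_derivative_def)
qed

text \<open>Brings the chain rule from the space enlarged by the noise back to \<open>M\<close>:
  both sides see the variables only through their laws.\<close>

lemma chain_rule_measure_preserving:
  fixes \<xi> :: "real \<Rightarrow> 'a \<Rightarrow> 'b::{banach, second_countable_topology}"
  assumes \<phi>: "\<phi> \<in> measurable N M" "distr N M \<phi> = M"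
    and meas: "\<And>\<epsilon>. \<epsilon> \<in> {0..1} \<Longrightarrow> \<xi> \<epsilon> \<in> borel_measurable M" "\<eta> \<in> borel_measurable M"
    and V: "continuous_on UNIV V"
    and chain: "chain_rule N f (\<lambda>\<epsilon> z. \<xi> \<epsilon> (\<phi> z)) (\<lambda>z. \<eta> (\<phi> z)) V"
  shows "chain_rule M f \<xi> \<eta> V"
proof -
  have [measurable]: "V \<in> borel_measurable borel" "\<xi> 0 \<in> borel_measurable M"
    using V meas(1)[of 0] by (auto intro: borel_measurable_continuous_onI)
  have m: "(\<lambda>\<omega>. blinfun_apply (V (\<xi> 0 \<omega>)) (\<eta> \<omega>)) \<in> borel_measurable M"
    using meas(2) by (intro blinfun_apply_measurable) measurable
  have "\<forall>\<^sub>F \<epsilon>::real in at_right 0. \<epsilon> \<in> {0<..<1}"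
    by (rule eventually_at_right_real) simp
  then have "\<forall>\<^sub>F \<epsilon> in at_right 0. (f (distr N borel (\<lambda>z. \<xi> \<epsilon> (\<phi> z))) - f (distr N borel (\<lambda>z. \<xi> 0 (\<phi> z)))) / \<epsilon>
      = (f (distr M borel (\<xi> \<epsilon>)) - f (distr M borel (\<xi> 0))) / \<epsilon>"
    by eventually_elim (simp add: distr_measure_preserving[OF \<phi> meas(1)])
  from tendsto_cong[OF this] show ?thesis
    using chain integrable_measure_preserving[OF \<phi> m] integral_measure_preserving[OF \<phi> m]
    by (simp add: chain_rule_def)
qed

section \<open>Uniform noise in a fixed direction\<close>

lemma (in prob_space) noise_no_atoms:
  fixes B :: "'a \<Rightarrow> 'b::{banach, second_countable_topology}"
  assumes B[measurable]: "B \<in> borel_measurable M" and v: "v \<noteq> 0" and s: "s \<noteq> 0"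
  shows "measure (distr (M \<Otimes>\<^sub>M uniform_measure lborel {0..1::real}) borel (\<lambda>z. B (fst z) + s *\<^sub>R snd z *\<^sub>R v)) {x} = 0"
proof -
  let ?U = "uniform_measure lborel {0..1::real}"
  interpret U: prob_space ?U by (rule prob_space_uniform_measure) auto
  interpret pair_sigma_finite M ?U ..
  define g where "g z = B (fst z) + s *\<^sub>R snd z *\<^sub>R v" for z
  have g[measurable]: "g \<in> borel_measurable (M \<Otimes>\<^sub>M ?U)"
    unfolding g_def by measurable
  \<comment> \<open>For fixed \<open>\<omega>\<close> the line
    \<open>B \<omega> + s *\<^sub>R u *\<^sub>R v\<close> passes through \<open>x\<close> for at
    most one \<open>u\<close>, which has Lebesgue measure 0; Fubini's theorem does the rest.\<close>
  have "AE z in M \<Otimes>\<^sub>M ?U. g z \<noteq> x"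
  proof (rule AE_pair_measure)
    show "AE \<omega> in M. AE u in ?U. g (\<omega>, u) \<noteq> x"
    proof (rule AE_I2)
      fix \<omega>
      show "AE u in ?U. g (\<omega>, u) \<noteq> x"
      proof (cases "\<exists>u0. B \<omega> + s *\<^sub>R u0 *\<^sub>R v = x")
        case True
        then obtain u0 where u0: "B \<omega> + s *\<^sub>R u0 *\<^sub>R v = x" by blast
        have "u = u0" if "B \<omega> + s *\<^sub>R u *\<^sub>R v = x" for u
        proof -
          have "s *\<^sub>R u *\<^sub>R v = s *\<^sub>R u0 *\<^sub>R v" using that u0 by (metis add_left_cancel)
          then show ?thesis using v s by simp
        qed
        moreover have "AE u in ?U. u \<noteq> u0"
          using AE_lborel_singleton[of u0] by (intro AE_uniform_measureI) auto
        ultimately show ?thesis by (auto simp: g_def elim: eventually_mono)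
      next
        case False
        then show ?thesis by (auto simp: g_def)
      qed
    qed
  qed measurable
  moreover have "{z \<in> space (M \<Otimes>\<^sub>M ?U). \<not> g z \<noteq> x} = g -` {x} \<inter> space (M \<Otimes>\<^sub>M ?U)"
    by auto
  moreover have "g -` {x} \<inter> space (M \<Otimes>\<^sub>M ?U) \<in> sets (M \<Otimes>\<^sub>M ?U)"
    using measurable_sets[OF g, of "{x}"] by simp
  ultimately have "emeasure (M \<Otimes>\<^sub>M ?U) (g -` {x} \<inter> space (M \<Otimes>\<^sub>M ?U)) = 0"
    using AE_iff_measurable[of "g -` {x} \<inter> space (M \<Otimes>\<^sub>M ?U)" "M \<Otimes>\<^sub>M ?U" "\<lambda>z. g z \<noteq> x"] by simp
  then have "measure (distr (M \<Otimes>\<^sub>M ?U) borel g) {x} = 0"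
    by (subst measure_distr[OF g]) (simp_all add: measure_def)
  then show ?thesis by (simp only: g_def[abs_def])
qed

lemma (in prob_space) noise_Lspace:
  fixes v :: "'b::{banach, second_countable_topology}"
  assumes "1 \<le> p"
  shows "(\<lambda>z. snd z *\<^sub>R v) \<in> Lspace (ereal p) (M \<Otimes>\<^sub>M uniform_measure lborel {0..1::real})"
proof -
  let ?U = "uniform_measure lborel {0..1::real}"
  interpret U: prob_space ?U by (rule prob_space_uniform_measure) auto
  interpret pair_prob_space M ?U ..
  have "AE z in M \<Otimes>\<^sub>M ?U. \<bar>snd z\<bar> \<le> 1"
  proof (rule AE_pair_measure)
    have "AE u in ?U. \<bar>u\<bar> \<le> 1" by (rule AE_uniform_measureI) auto
    then show "AE \<omega> in M. AE u in ?U. \<bar>snd (\<omega>, u)\<bar> \<le> 1" by simp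
  qed measurable
  then have "AE z in M \<Otimes>\<^sub>M ?U. norm (norm (snd z *\<^sub>R v) powr p) \<le> norm v powr p"
  proof eventually_elim
    case (elim z)
    have "norm (snd z *\<^sub>R v) \<le> 1 * norm v"
      using mult_right_mono[OF elim norm_ge_zero[of v]] by simp
    then have "norm (snd z *\<^sub>R v) powr p \<le> norm v powr p"
      using assms by (intro powr_mono2) auto
    then show ?case by simp
  qed
  then have "integrable (M \<Otimes>\<^sub>M ?U) (\<lambda>z. norm (snd z *\<^sub>R v) powr p)"
    by (rule integrable_const_bound) measurable
  then show ?thesis by (simp add: Lspace_ereal_iff)
qed

lemma (in prob_space) chain_rule_neighbourhood:
  fixes \<xi> :: "real \<Rightarrow> 'a \<Rightarrow> 'b::{banach, second_countable_topology}"
  assumes p: "1 \<le> p" and f: "W_continuous p f" and \<xi>: "\<And>\<epsilon>. \<epsilon> \<in> {0..1} \<Longrightarrow> \<xi> \<epsilon> \<in> Lspace (ereal p) M"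
    and deriv: "Lp_right_derivative p M \<xi> \<eta>"
    and U: "W_neighbourhood p (distr M borel (\<xi> 0)) U"
    and L: "\<And>\<mu>. \<mu> \<in> U \<Longrightarrow> has_L_derivative p f \<mu> (D \<mu>)"
    and V: "\<And>\<mu>. \<mu> \<in> U \<Longrightarrow> AE x in \<mu>. V \<mu> x = D \<mu> x" "W_jointly_continuous_on p U V"
      "\<And>\<mu>. \<mu> \<in> U \<Longrightarrow> growth_bound p C (V \<mu>)" "0 \<le> C"
    and cont: "continuous_on UNIV (V (distr M borel (\<xi> 0)))"
  shows "chain_rule M f \<xi> \<eta> (V (distr M borel (\<xi> 0)))"
proof (cases "\<forall>v::'b. v = 0")
  \<comment> \<open>The zero space offers no direction for the noise; there all variables coincide
    and both sides are 0.\<close>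
  case True
  then have "\<xi> \<epsilon> = \<xi> 0" for \<epsilon> by (metis ext)
  then have "(\<lambda>\<epsilon>. (f (distr M borel (\<xi> \<epsilon>)) - f (distr M borel (\<xi> 0))) / \<epsilon>) = (\<lambda>\<epsilon>. 0)"
    by (metis diff_self div_0)
  moreover have "\<eta> \<omega> = 0" for \<omega> using True by blast
  ultimately show ?thesis
    by (simp add: chain_rule_def blinfun.zero_right)
next
  case False
  then obtain v :: 'b where v: "v \<noteq> 0" by blast
  let ?N = "M \<Otimes>\<^sub>M uniform_measure lborel {0..1::real}"
  interpret U: prob_space "uniform_measure lborel {0..1::real}" by (rule prob_space_uniform_measure) auto
  interpret N: pair_prob_space M "uniform_measure lborel {0..1::real}" ..
  have fst: "fst \<in> measurable ?N M" "distr ?N M fst = M"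
    by (auto simp: U.distr_pair_fst)
  have \<xi>m: "\<xi> \<epsilon> \<in> borel_measurable M" if "\<epsilon> \<in> {0..1}" for \<epsilon>
    using \<xi>[OF that] by (simp add: Lspace_ereal_iff)
  have \<eta>: "\<eta> \<in> borel_measurable M"
    using deriv by (simp add: Lp_right_derivative_def Lspace_ereal_iff)
  have law0: "distr ?N borel (\<lambda>z. \<xi> 0 (fst z)) = distr M borel (\<xi> 0)"
    using \<xi>m[of 0] by (intro distr_measure_preserving fst) simp
  have "chain_rule ?N f (\<lambda>\<epsilon> z. \<xi> \<epsilon> (fst z)) (\<lambda>z. \<eta> (fst z)) (V (distr ?N borel (\<lambda>z. \<xi> 0 (fst z))))"
  proof (rule N.P.chain_rule_with_noise[OF p f _ _ _ L V noise_Lspace[OF p, of v]])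
    show "(\<lambda>z. \<xi> \<epsilon> (fst z)) \<in> Lspace (ereal p) ?N" if "\<epsilon> \<in> {0..1}" for \<epsilon>
      by (rule Lspace_measure_preserving[OF fst \<xi>[OF that]])
    show "Lp_right_derivative p ?N (\<lambda>\<epsilon> z. \<xi> \<epsilon> (fst z)) (\<lambda>z. \<eta> (fst z))"
      by (rule Lp_right_derivative_measure_preserving[OF p fst \<xi> deriv])
    show "W_neighbourhood p (distr ?N borel (\<lambda>z. \<xi> 0 (fst z))) U"
      unfolding law0 by (rule U)
    fix \<epsilon> s t :: real and x assume \<epsilon>: "\<epsilon> \<in> {0..1}" and s: "0 < s"
    \<comment> \<open>\<open>B\<close> is the part without noise. It depends on the first coordinate
      only, so \<open>noise_no_atoms\<close> applies for every \<open>t\<close>.\<close>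
    define B where "B \<omega> = \<xi> 0 \<omega> + t *\<^sub>R (\<xi> \<epsilon> \<omega> - \<xi> 0 \<omega>)" for \<omega>
    have "B \<in> borel_measurable M"
      using \<xi>m[OF \<epsilon>] \<xi>m[of 0] unfolding B_def by measurable
    from noise_no_atoms[OF this v, of s x] s
    show "measure (distr ?N borel (\<lambda>z. (\<xi> 0 (fst z) + s *\<^sub>R snd z *\<^sub>R v) + t *\<^sub>R (\<xi> \<epsilon> (fst z) - \<xi> 0 (fst z)))) {x} = 0"
      by (simp add: B_def algebra_simps)
  qed
  then show ?thesis
    unfolding law0 by (intro chain_rule_measure_preserving[OF fst \<xi>m \<eta> cont])
qed

theorem theorem2p1:
  fixes M :: "'w measure"
    and p :: real
    and f :: "'b::{banach, second_countable_topology} measure \<Rightarrow> real"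
    and \<xi> :: "real \<Rightarrow> 'w \<Rightarrow> 'b"
    and \<eta> :: "'w \<Rightarrow> 'b"
    and \<mu>\<^sub>0 :: "'b measure"
  assumes "1 \<le> p"
    and "W_continuous p f"
    and "prob_space M" and "complete_measure M"
    and "\<And>\<epsilon>. \<epsilon> \<in> {0..1} \<Longrightarrow> \<xi> \<epsilon> \<in> borel_measurable M"
    and "\<And>\<epsilon>. \<epsilon> \<in> {0..1} \<Longrightarrow> distr M borel (\<xi> \<epsilon>) \<in> Prob_p p"
    and "Lp_right_derivative p M \<xi> \<eta>"
    and "(AE \<omega> in M. continuous_on {0..1} (\<lambda>\<epsilon>. \<xi> \<epsilon> \<omega>)) \<or> Polish_prob_space M"
    and "\<mu>\<^sub>0 = distr M borel (\<xi> 0)"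
  shows
    "(\<forall>D V C.
        atomless \<mu>\<^sub>0 \<and> has_L_derivative p f \<mu>\<^sub>0 D \<and>
        (AE x in \<mu>\<^sub>0. V x = D x) \<and> continuous_on UNIV V \<and>
        C > 0 \<and> growth_bound p C V
        \<longrightarrow> chain_rule M f \<xi> \<eta> D) \<and>
     (\<forall>U D V C.
        W_neighbourhood p \<mu>\<^sub>0 U \<and> (\<forall>\<mu>\<in>U. has_L_derivative p f \<mu> (D \<mu>)) \<and>
        (\<forall>\<mu>\<in>U. AE x in \<mu>. V \<mu> x = D \<mu> x) \<and> W_jointly_continuous_on p U V \<and>
        C > 0 \<and> (\<forall>\<mu>\<in>U. growth_bound p C (V \<mu>))
        \<longrightarrow> chain_rule M f \<xi> \<eta> (D \<mu>\<^sub>0))"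
proof -
  interpret prob_space M by fact
  have \<xi>: "\<xi> \<epsilon> \<in> Lspace (ereal p) M" if "\<epsilon> \<in> {0..1}" for \<epsilon>
    using assms(6)[OF that] distr_in_Prob_p_iff[OF assms(5)[OF that]] by blast
  have \<xi>0: "\<xi> 0 \<in> borel_measurable M" using assms(5)[of 0] by simp
  have \<eta>: "\<eta> \<in> borel_measurable M"
    using assms(7) by (simp add: Lp_right_derivative_def Lspace_ereal_iff)
  have D_meas: "D \<in> borel_measurable \<mu>" if "has_L_derivative p f \<mu> D" for \<mu> D
    using that by (simp add: has_L_derivative_def has_intrinsic_derivative_def Lspace_def strongly_measurable_def)
  show ?thesis unfolding \<open>\<mu>\<^sub>0 = _\<close>
  proof (intro conjI allI impI; elim conjE)
    fix D V and C :: real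
    assume at: "atomless (distr M borel (\<xi> 0))" and L: "has_L_derivative p f (distr M borel (\<xi> 0)) D"
      and V: "AE x in distr M borel (\<xi> 0). V x = D x" "continuous_on UNIV V" "growth_bound p C V" and C: "C > 0"
    have no_atoms: "measure (distr M borel (\<xi> 0)) {x} = 0" for x
      using at by (rule atomless_measure_singleton) simp
    have "chain_rule M f \<xi> \<eta> V"
      using chain_rule_atomless[OF assms(1,2) \<xi> assms(7) no_atoms L V] C by simp
    then show "chain_rule M f \<xi> \<eta> D"
      by (rule chain_rule_cong_AE[where \<xi>=\<xi> and \<eta>=\<eta> and V=V and D=D, OF _ V(2) D_meas[OF L] V(1) \<xi>0 \<eta>])
  next
    fix U D V and C :: real
    assume U: "W_neighbourhood p (distr M borel (\<xi> 0)) U" and L: "\<forall>\<mu>\<in>U. has_L_derivative p f \<mu> (D \<mu>)"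
      and V: "\<forall>\<mu>\<in>U. AE x in \<mu>. V \<mu> x = D \<mu> x" "W_jointly_continuous_on p U V" "\<forall>\<mu>\<in>U. growth_bound p C (V \<mu>)" and C: "C > 0"
    have law0: "distr M borel (\<xi> 0) \<in> Prob_p p" using assms(6)[of 0] by simp
    then have mem: "distr M borel (\<xi> 0) \<in> U"
      using U Wasserstein_refl[OF law0] assms(1) unfolding W_neighbourhood_def by force
    have cont: "continuous_on UNIV (V (distr M borel (\<xi> 0)))"
      using U assms(1) by (intro W_jointly_continuous_on_imp_continuous_on[OF V(2) mem]) (auto simp: W_neighbourhood_def)
    have "chain_rule M f \<xi> \<eta> (V (distr M borel (\<xi> 0)))"
      using L V C by (intro chain_rule_neighbourhood[OF assms(1,2) \<xi> assms(7) U _ _ V(2) _ _ cont]) auto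
    then show "chain_rule M f \<xi> \<eta> (D (distr M borel (\<xi> 0)))"
      by (rule chain_rule_cong_AE[where \<xi>=\<xi> and \<eta>=\<eta> and V="V (distr M borel (\<xi> 0))", OF _ cont D_meas _ \<xi>0 \<eta>]) (use L V(1) mem in auto)
  qed
qed

end
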